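(* There exist infinitely many connected graphs $G$ with maximum degree $4$ such that, writing $n$ for the number of vertices of $G$, the second eigenvalue multiplicity of $G$ is at least $\sqrt{n/\log_2 n}$.
   Context: All graphs are finite and undirected. Eigenvalues of a graph $G$ always refer to its adjacency matrix and are listed in descending order with multiplicity as $\lambda_1(G)\ge\lambda_2(G)\ge\cdots\ge\lambda_{|V(G)|}(G)$. The second eigenvalue multiplicity of $G$ is the number of indices $j$ with $\lambda_j(G)=\lambda_2(G)$. *)

theory Defs
  imports
    Complex_Main
    "Graph_Theory.Graph_Theory"
    "Jordan_Normal_Form.Char_Poly"
begin

text \<open>
  A finite simple undirected graph is a \<open>pair_graph\<close>: finitely many vertices, no loops, and a
  symmetric set of arcs, so that an edge between \<open>u\<close> and \<open>v\<close> is the pair of arcs \<open>(u, v)\<close>, \<open>(v, u)\<close>.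
\<close>

text \<open>
  The linear order on the vertex type only serves to number the rows and columns; another
  numbering conjugates the matrix by a permutation matrix.
\<close>

definition adjacency_mat :: "'a::linorder pair_pre_digraph \<Rightarrow> real mat" where
  "adjacency_mat G =
     (let vs = sorted_list_of_set (pverts G); n = card (pverts G)
      in mat n n (\<lambda>(i, j). if (vs ! i, vs ! j) \<in> parcs G then 1 else 0))"

text \<open>
  \<open>proots\<close> collects the real roots of the characteristic polynomial with their multiplicities;
  \<open>length_eigenvalue_list\<close> below shows that these are all \<open>n\<close> of them.
\<close>

definition eigenvalue_list :: "'a::linorder pair_pre_digraph \<Rightarrow> real list" where
  "eigenvalue_list G =
     rev (sorted_list_of_multiset (proots (char_poly (adjacency_mat G))))"

text \<open>Indexed from 1: \<open>nth_eigenvalue G 1 \<ge> nth_eigenvalue G 2 \<ge> \<dots>\<close>\<close>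

definition nth_eigenvalue :: "'a::linorder pair_pre_digraph \<Rightarrow> nat \<Rightarrow> real" where
  "nth_eigenvalue G j = eigenvalue_list G ! (j - 1)"

definition second_eigenvalue_multiplicity :: "'a::linorder pair_pre_digraph \<Rightarrow> nat" where
  "second_eigenvalue_multiplicity G =
     card {j \<in> {1..card (pverts G)}. nth_eigenvalue G j = nth_eigenvalue G 2}"

text \<open>In a symmetric digraph the out-degree of a vertex is its number of neighbours.\<close>

definition max_degree :: "'a pair_pre_digraph \<Rightarrow> nat" where
  "max_degree G = Max (out_degree (with_proj G) ` pverts G)"

lemma symmetric_real_mat_eigenvalue_real:
  fixes A :: "real mat" and a :: complex
  assumes A: "A \<in> carrier_mat n n" and sym: "A\<^sup>T = A"
    and ev: "eigenvalue (map_mat complex_of_real A) a"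
  shows "a \<in> \<real>"
proof -
  let ?B = "map_mat complex_of_real A"
  have B: "?B \<in> carrier_mat n n" using A by simp
  have BT: "?B\<^sup>T = ?B"
    using arg_cong[OF sym, of "map_mat complex_of_real"] A
    by (simp add: mat_eq_iff)
  from ev A obtain v where v: "v \<in> carrier_vec n" "v \<noteq> 0\<^sub>v n" and Bv: "?B *\<^sub>v v = a \<cdot>\<^sub>v v"
    unfolding eigenvalue_def eigenvector_def by auto
  let ?w = "conjugate v"
  have w: "?w \<in> carrier_vec n" using v by simp
  have "?B *\<^sub>v ?w = conjugate (?B *\<^sub>v v)"
    using A v by (intro eq_vecI) (auto simp: scalar_prod_def)
  also have "\<dots> = cnj a \<cdot>\<^sub>v ?w"
    using v by (simp add: Bv) (auto intro!: eq_vecI)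
  finally have Bw: "?B *\<^sub>v ?w = cnj a \<cdot>\<^sub>v ?w" .
  have "(?B *\<^sub>v ?w) \<bullet> v = ?w \<bullet> (?B *\<^sub>v v)"
    using transpose_vec_mult_scalar[OF B v(1) w] BT by simp
  hence "cnj a * (?w \<bullet> v) = a * (?w \<bullet> v)"
    using v w by (simp add: Bv Bw)
  moreover have "?w \<bullet> v = v \<bullet>c v" by (rule comm_scalar_prod[OF w v(1)])
  moreover have "v \<bullet>c v \<noteq> 0" using v conjugate_square_eq_0_vec[OF v(1)] by simp
  ultimately have "cnj a = a" by simp
  thus ?thesis by (simp add: Reals_cnj_iff)
qed

lemma symmetric_real_mat_size_proots:
  fixes A :: "real mat"
  assumes A: "A \<in> carrier_mat n n" and sym: "A\<^sup>T = A"
  shows "size (proots (char_poly A)) = n"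
proof -
  let ?B = "map_mat complex_of_real A"
  have B: "?B \<in> carrier_mat n n" using A by simp
  obtain as where as: "char_poly ?B = (\<Prod>a\<leftarrow>as. [:- a, 1:])" "length as = n"
    using char_poly_factorized[OF B] by blast
  have real: "a \<in> \<real>" if "a \<in> set as" for a
  proof -
    have "poly (char_poly ?B) a = 0"
      using that unfolding as(1) by (induction as) auto
    hence "eigenvalue ?B a" using eigenvalue_root_char_poly[OF B] by simp
    thus ?thesis using symmetric_real_mat_eigenvalue_real[OF A sym] by blast
  qed
  have split: "map_poly complex_of_real (\<Prod>a\<leftarrow>bs. [:- Re a, 1:]) = (\<Prod>a\<leftarrow>bs. [:- a, 1:])"
    if "set bs \<subseteq> set as" for bs
    using that
  proof (induction bs)
    case (Cons b bs)
    have b: "map_poly complex_of_real [:- Re b, 1:] = [:- b, 1:]"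
      using real[of b] Cons.prems by (simp add: map_poly_pCons)
    have "map_poly complex_of_real (\<Prod>a\<leftarrow>b # bs. [:- Re a, 1:]) =
      map_poly complex_of_real [:- Re b, 1:] * map_poly complex_of_real (\<Prod>a\<leftarrow>bs. [:- Re a, 1:])"
      unfolding list.map prod_list.Cons by (rule poly_eqI) (simp only: coeff_mult coeff_map_poly of_real_0 of_real_sum of_real_mult)
    thus ?case using Cons b by simp
  qed simp
  have "map_poly complex_of_real (char_poly A) = map_poly complex_of_real (\<Prod>a\<leftarrow>as. [:- Re a, 1:])"
    using of_real_hom.char_poly_hom[OF A, where ?'a = complex] as(1) split[of as] by simp
  hence cp: "char_poly A = (\<Prod>a\<leftarrow>as. [:- Re a, 1:])"
    by (simp add: poly_eq_iff coeff_map_poly)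
  have "size (proots (\<Prod>a\<leftarrow>bs. [:- Re a, 1:])) = length bs" for bs
  proof (induction bs)
    case (Cons b bs)
    have "(\<Prod>a\<leftarrow>bs. [:- Re a, 1:]) \<noteq> 0" by auto
    hence "proots (\<Prod>a\<leftarrow>b # bs. [:- Re a, 1:]) =
      proots [:- Re b, 1:] + proots (\<Prod>a\<leftarrow>bs. [:- Re a, 1:])"
      unfolding list.map prod_list.Cons by (intro proots_mult) auto
    thus ?case using Cons by simp
  qed simp
  thus ?thesis using cp as(2) by simp
qed

lemma length_eigenvalue_list:
  fixes G :: "'a::linorder pair_pre_digraph"
  assumes "pair_graph G"
  shows "length (eigenvalue_list G) = card (pverts G)"
proof -
  interpret pair_graph G by fact
  let ?A = "adjacency_mat G"
  have A: "?A \<in> carrier_mat (card (pverts G)) (card (pverts G))"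
    by (simp add: adjacency_mat_def Let_def)
  have "(u, v) \<in> parcs G \<longleftrightarrow> (v, u) \<in> parcs G" for u v
    using pair_sym_arcs by (auto simp: symmetric_def dest: symD)
  hence "?A\<^sup>T = ?A"
    by (intro eq_matI) (auto simp: adjacency_mat_def Let_def)
  hence "size (proots (char_poly ?A)) = card (pverts G)"
    by (rule symmetric_real_mat_size_proots[OF A])
  thus ?thesis
    by (metis eigenvalue_list_def length_rev size_mset mset_sorted_list_of_multiset)
qed

end

(*
  Take p copies, indexed by Z/p, of a layered graph whose L layers are each a copy of the cyclic
  group Z/(p-1), written multiplicatively as the powers gamma(x) of a primitive root. Consecutive
  layers are joined by x ~ x and x ~ x + v_s, and the bottom layers of the copies are joined by the
  perfect matching (i, x) ~ (i + gamma(x), x + (p-1)/2), that is, i and c in (Z/p)^* are sent to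
  i + c and -c. The affine group of Z/p acts on this graph of maximum degree 4.

  Functions whose sum over i vanishes: the dilations permute the nontrivial characters of Z/p
  transitively, so every eigenvalue occurring here has multiplicity at least p - 1. A test function
  that is constant on layers shows that the largest such eigenvalue mu is at least
  4 cos(pi/(L+1)) - 1/(p-1), since the matching then contributes almost nothing.

  Functions that do not depend on i: a character of Z/(p-1) with frequency a turns the layered graph
  into a weighted path with weights |1 + e(a v_s/(p-1))|. The shifts v_s contain the powers of 2, so
  if a is nonzero then some weight well inside the path is at most sqrt 2, and the largest eigenvalue
  drops below 4 cos(pi/L) < mu. For a = 0, two eigenfunctions on the path with eigenvalues above
  4 cos(pi/L) are both of constant sign, hence not orthogonal. Thus only one eigenvalue exceeds mu.
  Since L = log_2 p + O(1), the graph has n = p (p - 1) L vertices with n / log_2 n at most (p-1)^2.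
*)
theory Submission
  imports
    "HOL-Analysis.Function_Topology"
    "HOL-Analysis.Topology_Euclidean_Space"
    "HOL-Number_Theory.Residue_Primitive_Roots"
    Defs
begin

section \<open>Eigenfunctions on a finite set\<close>

text \<open>The affine group has order p (p - 1) and an irreducible representation of dimension p -
  1, nearly the square root of its order and so nearly the most that a group can force. Each layer
  is one free orbit of it, whence multiplicity of order sqrt(n / L). The difficulty is the position
  of \<open>\<mu>\<close>, which only one eigenvalue may exceed. The window between 4 cos(pi/L) and
  4 cos(pi/(L+1)) has width of order 1/L^3, so the loss 1/(p - 1) fits into it once (L+1)^3 <= p -
  1. On functions independent of i the matching becomes a loop of modulus 1 at the end of the path,
  which can push eigenvalues up; at a nonzero frequency one weight of at most sqrt 2 in the interior
  has to outweigh it. Providing such a weight for all p - 2 nonzero frequencies by powers of 2 takes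
  about log_2 p layers, and this is the source of the logarithm.\<close>

definition ip :: "'a set \<Rightarrow> ('a \<Rightarrow> complex) \<Rightarrow> ('a \<Rightarrow> complex) \<Rightarrow> complex" where
  "ip V f g = (\<Sum>v\<in>V. f v * cnj (g v))"

text \<open>Operators act on functions, not vectors, so that characters on triples can be used as
  they are; a numbering of the vertices is brought in only where matrices are.\<close>

definition kop :: "'a set \<Rightarrow> ('a \<Rightarrow> 'a \<Rightarrow> real) \<Rightarrow> ('a \<Rightarrow> complex) \<Rightarrow> 'a \<Rightarrow> complex" where
  "kop V a f v = (\<Sum>w\<in>V. of_real (a v w) * f w)"

lemma ip_add_left: "ip V (\<lambda>v. f v + g v) h = ip V f h + ip V g h"
  and ip_add_right: "ip V h (\<lambda>v. f v + g v) = ip V h f + ip V h g"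
  and ip_diff_left: "ip V (\<lambda>v. f v - g v) h = ip V f h - ip V g h"
  and ip_scale_left: "ip V (\<lambda>v. c * f v) h = c * ip V f h"
  and ip_scale_right: "ip V h (\<lambda>v. c * f v) = cnj c * ip V h f"
  by (simp_all add: ip_def algebra_simps sum.distrib sum_subtractf sum_distrib_left)

lemma ip_cnj: "cnj (ip V f g) = ip V g f"
  by (simp add: ip_def mult.commute)

lemma Re_ip_commute: "Re (ip V f g) = Re (ip V g f)"
  by (metis ip_cnj cnj.sel(1))

lemma ip_cong: "(\<And>v. v \<in> V \<Longrightarrow> f v = f' v) \<Longrightarrow> (\<And>v. v \<in> V \<Longrightarrow> g v = g' v) \<Longrightarrow> ip V f g = ip V f' g'"
  by (simp add: ip_def)

lemma ip_self: "ip V f f = of_real (\<Sum>v\<in>V. (cmod (f v))\<^sup>2)"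
  by (simp add: ip_def complex_norm_square del: of_real_power)

lemma ip_self_nonneg: "Re (ip V f f) \<ge> 0"
  by (simp add: ip_self sum_nonneg)

lemma ip_self_eq_0_iff: "finite V \<Longrightarrow> ip V f f = 0 \<longleftrightarrow> (\<forall>v\<in>V. f v = 0)"
  by (simp add: ip_self sum_nonneg_eq_0_iff del: of_real_sum)

lemma kop_add: "kop V a (\<lambda>v. f v + g v) v = kop V a f v + kop V a g v"
  and kop_diff: "kop V a (\<lambda>v. f v - g v) v = kop V a f v - kop V a g v"
  and kop_scale: "kop V a (\<lambda>v. c * f v) v = c * kop V a f v"
  by (simp_all add: kop_def algebra_simps sum.distrib sum_subtractf sum_distrib_left)

lemma kop_cong: "(\<And>v. v \<in> V \<Longrightarrow> f v = g v) \<Longrightarrow> kop V a f v = kop V a g v"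
  by (simp add: kop_def)

lemma kop_adjoint:
  assumes "\<And>v w. v \<in> V \<Longrightarrow> w \<in> V \<Longrightarrow> a v w = a w v"
  shows "ip V (kop V a f) g = ip V f (kop V a g)"
proof -
  have "ip V (kop V a f) g = (\<Sum>v\<in>V. \<Sum>w\<in>V. of_real (a v w) * f w * cnj (g v))"
    by (simp add: ip_def kop_def sum_distrib_right)
  also have "\<dots> = (\<Sum>w\<in>V. \<Sum>v\<in>V. of_real (a v w) * f w * cnj (g v))"
    by (rule sum.swap)
  also have "\<dots> = ip V f (kop V a g)"
    using assms by (auto simp: ip_def kop_def sum_distrib_left intro!: sum.cong)
  finally show ?thesis .
qed

section \<open>The variational principle for a symmetric kernel\<close>

lemma quadratic_nonneg_imp_linear_zero:
  fixes c d :: real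
  assumes "\<And>t. 0 \<le> t * c + t\<^sup>2 * d"
  shows "c = 0"
proof (rule ccontr)
  assume c: "c \<noteq> 0"
  \<comment> \<open>A step against the sign of \<open>c\<close>, of the length at which
    \<open>t\<^sup>2 * (\<bar>d\<bar> + 1)\<close> cancels \<open>t * c\<close>; the added 1 keeps
    the denominator nonzero and the inequality strict.\<close>
  define t where "t = - c / (\<bar>d\<bar> + 1)"
  have "t * c + t\<^sup>2 * d \<le> t * c + t\<^sup>2 * \<bar>d\<bar>"
    by (intro add_left_mono mult_left_mono) auto
  also have "\<dots> < t * c + t\<^sup>2 * (\<bar>d\<bar> + 1)"
    using c by (simp add: t_def algebra_simps)
  also have "\<dots> = 0"
  proof -
    have d: "\<bar>d\<bar> + 1 \<noteq> 0" by linarith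
    hence "t * (\<bar>d\<bar> + 1) = - c" by (simp add: t_def)
    hence "t\<^sup>2 * (\<bar>d\<bar> + 1) = - (t * c)" by (simp add: power2_eq_square mult.assoc)
    thus ?thesis by simp
  qed
  finally show False using assms[of t] by simp
qed

lemma compact_PiE_fun:
  fixes S :: "'a \<Rightarrow> 'b::topological_space set"
  assumes "\<And>i. compact (S i)"
  shows "compact (PiE UNIV S)"
proof -
  have "compactin (product_topology (\<lambda>i. euclidean) UNIV) (PiE UNIV S)"
    using assms by (simp add: compactin_PiE)
  thus ?thesis by (simp add: euclidean_product_topology)
qed

lemma continuous_on_coord: "continuous_on A (\<lambda>f :: 'a \<Rightarrow> complex. f v)"
  by (rule continuous_on_subset[OF continuous_on_product_coordinates]) simp

lemma continuous_on_ip_left: "continuous_on A (\<lambda>f. ip V f g)"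
  unfolding ip_def by (intro continuous_intros continuous_on_coord)

lemma continuous_on_ip_self: "continuous_on A (\<lambda>f. ip V f f)"
  unfolding ip_def by (intro continuous_intros continuous_on_coord)

lemma continuous_on_form: "continuous_on A (\<lambda>f. ip V (kop V a f) f)"
  unfolding ip_def kop_def by (intro continuous_intros continuous_on_coord)

text \<open>Vanishing outside \<open>V\<close> pins the coordinates that \<open>ip\<close> does not
  see; this makes the unit sphere compact in the product topology although the vertex type may be
  infinite.\<close>

definition supported_orth :: "'a set \<Rightarrow> ('a \<Rightarrow> complex) set \<Rightarrow> ('a \<Rightarrow> complex) set" where
  "supported_orth V B = {f. (\<forall>v. v \<notin> V \<longrightarrow> f v = 0) \<and> (\<forall>g\<in>B. ip V f g = 0)}"

lemma closed_supported_orth: "closed (supported_orth V B)"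
proof -
  have eq: "supported_orth V B = (\<Inter>v\<in>-V. {f. f v = 0}) \<inter> (\<Inter>g\<in>B. {f. ip V f g = 0})"
    by (auto simp: supported_orth_def)
  show ?thesis unfolding eq
    by (intro closed_Int closed_INT ballI closed_Collect_eq continuous_on_coord
        continuous_on_ip_left continuous_on_const)
qed

text \<open>The Rayleigh quotient attains its maximum on the compact unit sphere, and the
  first-order condition there is the eigenvalue equation. It serves twice: with \<open>B\<close> a
  list of eigenfunctions it builds eigenbases, and with \<open>B\<close> the fibre indicators it
  yields the eigenvalue \<open>\<mu>\<close> of the graph together with its variational
  bound.\<close>

lemma top_eigenfunction:
  assumes fin: "finite V"
    and sym: "\<And>v w. v \<in> V \<Longrightarrow> w \<in> V \<Longrightarrow> a v w = a w v"
    and inv: "\<And>f g. f \<in> supported_orth V B \<Longrightarrow> g \<in> B \<Longrightarrow> ip V (kop V a f) g = 0"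
    and ex: "f0 \<in> supported_orth V B" "v0 \<in> V" "f0 v0 \<noteq> 0"
  shows "\<exists>\<mu> u. u \<in> supported_orth V B \<and> ip V u u = 1 \<and>
    (\<forall>v\<in>V. kop V a u v = of_real \<mu> * u v) \<and>
    (\<forall>f\<in>supported_orth V B. Re (ip V (kop V a f) f) \<le> \<mu> * Re (ip V f f))"
proof -
  let ?S = "supported_orth V B"
  let ?q = "\<lambda>f. Re (ip V (kop V a f) f)"
  have scale: "(\<lambda>v. c * f v) \<in> ?S" if "f \<in> ?S" for c f
    using that by (auto simp: supported_orth_def ip_scale_left)
  have add: "(\<lambda>v. f v + g v) \<in> ?S" if "f \<in> ?S" "g \<in> ?S" for f g
    using that by (auto simp: supported_orth_def ip_add_left)
  have normalise: "\<exists>r>0. r\<^sup>2 = Re (ip V f f) \<and> (\<lambda>v. of_real (1 / r) * f v) \<in> ?S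
      \<and> ip V (\<lambda>v. of_real (1 / r) * f v) (\<lambda>v. of_real (1 / r) * f v) = 1"
    if f: "f \<in> ?S" "v \<in> V" "f v \<noteq> 0" for f v
  proof -
    define r where "r = sqrt (Re (ip V f f))"
    have "ip V f f \<noteq> 0" using ip_self_eq_0_iff[OF fin, of f] f by blast
    moreover have im: "ip V f f = of_real (Re (ip V f f))" by (simp add: ip_self)
    ultimately have "Re (ip V f f) > 0" using ip_self_nonneg[of V f]
      by (metis less_eq_real_def of_real_0)
    hence r: "r > 0" "r\<^sup>2 = Re (ip V f f)" by (auto simp: r_def)
    have "ip V (\<lambda>v. of_real (1 / r) * f v) (\<lambda>v. of_real (1 / r) * f v)
      = of_real (1 / r) * (of_real (1 / r) * of_real (r\<^sup>2))"
      by (subst ip_scale_left, subst ip_scale_right, subst r(2)) (simp add: im[symmetric])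
    also have "\<dots> = 1" using r(1) by (simp add: power2_eq_square)
    finally show ?thesis using r scale[OF f(1)] by blast
  qed
  define K where "K = {f \<in> ?S. ip V f f = 1}"
  have "K \<subseteq> PiE UNIV (\<lambda>v. if v \<in> V then cball (0::complex) 1 else {0})"
  proof
    fix f assume f: "f \<in> K"
    have "cmod (f v) \<le> 1" if "v \<in> V" for v
    proof -
      have "(cmod (f v))\<^sup>2 \<le> (\<Sum>v\<in>V. (cmod (f v))\<^sup>2)"
        using that fin by (intro member_le_sum) auto
      also have "\<dots> = 1"
      proof -
        have "complex_of_real (\<Sum>v\<in>V. (cmod (f v))\<^sup>2) = of_real 1"
          using f by (simp add: K_def ip_self)
        thus ?thesis by (simp only: of_real_eq_iff)
      qed
      finally show ?thesis by (simp add: abs_square_le_1)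
    qed
    thus "f \<in> PiE UNIV (\<lambda>v. if v \<in> V then cball (0::complex) 1 else {0})"
      using f by (auto simp: K_def supported_orth_def)
  qed
  moreover have "compact (PiE UNIV (\<lambda>v::'a. if v \<in> V then cball (0::complex) 1 else {0}))"
    by (rule compact_PiE_fun) auto
  moreover have "closed K"
  proof -
    have "K = ?S \<inter> {f. ip V f f = 1}" by (auto simp: K_def)
    thus ?thesis by (auto intro!: closed_Int closed_supported_orth closed_Collect_eq
          continuous_on_ip_self)
  qed
  ultimately have K: "compact K"
    by (metis compact_Int_closed inf.absorb_iff2)
  moreover have "K \<noteq> {}" using normalise[OF ex] by (auto simp: K_def)
  moreover have "continuous_on K ?q"
    by (intro continuous_intros continuous_on_form)
  ultimately obtain u where u: "u \<in> K" and umax: "\<And>f. f \<in> K \<Longrightarrow> ?q f \<le> ?q u"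
    using continuous_attains_sup[of K ?q] by blast
  define \<mu> where "\<mu> = ?q u"
  have uS: "u \<in> ?S" and u1: "ip V u u = 1" using u by (auto simp: K_def)
  have bound: "?q f \<le> \<mu> * Re (ip V f f)" if f: "f \<in> ?S" for f
  proof (cases "\<exists>v\<in>V. f v \<noteq> 0")
    case True
    then obtain v where "v \<in> V" "f v \<noteq> 0" by blast
    then obtain r where r: "r > 0" "r\<^sup>2 = Re (ip V f f)"
      and g: "(\<lambda>v. of_real (1 / r) * f v) \<in> ?S"
        "ip V (\<lambda>v. of_real (1 / r) * f v) (\<lambda>v. of_real (1 / r) * f v) = 1"
      using normalise[OF f] by blast
    have "?q (\<lambda>v. of_real (1 / r) * f v) = (1 / r)\<^sup>2 * ?q f"
      unfolding kop_scale[abs_def] ip_scale_left ip_scale_right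
      by (simp add: power2_eq_square)
    moreover have "?q (\<lambda>v. of_real (1 / r) * f v) \<le> \<mu>"
      unfolding \<mu>_def using g by (intro umax) (auto simp: K_def)
    ultimately have "(1 / r)\<^sup>2 * ?q f \<le> \<mu>" by linarith
    hence "r\<^sup>2 * ((1 / r)\<^sup>2 * ?q f) \<le> r\<^sup>2 * \<mu>" by (rule mult_left_mono) simp
    moreover have "r\<^sup>2 * ((1 / r)\<^sup>2 * x) = x" for x
      using r(1) by (simp add: power_one_over)
    ultimately have "?q f \<le> \<mu> * r\<^sup>2" by (simp add: mult.commute)
    thus ?thesis using r(2) by simp
  next
    case False
    hence "ip V f f = 0" "ip V (kop V a f) f = 0"
      using ip_self_eq_0_iff[OF fin] by (auto simp: ip_def)
    thus ?thesis by simp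
  qed
  \<comment> \<open>The residual of the eigenvalue equation. By \<open>inv\<close> it lies in the
    same space, so \<open>u\<close> may be varied in its own direction; it is cut off outside
    \<open>V\<close>, where \<open>kop\<close> need not vanish.\<close>
  define w where "w v = (if v \<in> V then of_real \<mu> * u v - kop V a u v else 0)" for v
  have wS: "w \<in> ?S"
  proof -
    have "ip V w g = 0" if "g \<in> B" for g
    proof -
      have "ip V w g = ip V (\<lambda>v. of_real \<mu> * u v - kop V a u v) g"
        by (rule ip_cong) (auto simp: w_def)
      thus ?thesis using that uS inv[OF uS that]
        by (simp add: ip_diff_left ip_scale_left supported_orth_def)
    qed
    thus ?thesis by (auto simp: supported_orth_def w_def)
  qed
  have ww: "ip V w w = of_real \<mu> * ip V u w - ip V (kop V a u) w"
  proof -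
    have "ip V w w = ip V (\<lambda>v. of_real \<mu> * u v - kop V a u v) w"
      by (rule ip_cong) (auto simp: w_def)
    thus ?thesis by (simp add: ip_diff_left ip_scale_left)
  qed
  \<comment> \<open>The right-hand side is the slack in \<open>bound\<close> at
    \<open>u + t w\<close>. It vanishes at \<open>t = 0\<close>, so its linear coefficient, twice
    the squared norm of \<open>w\<close>, must be zero.\<close>
  have "0 \<le> t * (2 * Re (ip V w w)) + t\<^sup>2 * (\<mu> * Re (ip V w w) - ?q w)" for t :: real
  proof -
    let ?f = "\<lambda>v. u v + of_real t * w v"
    have f: "?f \<in> ?S" by (intro add scale uS wS)
    have wu: "Re (ip V w u) = Re (ip V u w)"
      by (rule Re_ip_commute)
    have kwu: "Re (ip V (kop V a w) u) = Re (ip V (kop V a u) w)"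
      using kop_adjoint[where V = V and a = a and f = w and g = u, OF sym] Re_ip_commute[of V w] by simp
    have norm: "Re (ip V ?f ?f) = 1 + 2 * t * Re (ip V u w) + t\<^sup>2 * Re (ip V w w)"
      unfolding ip_add_left ip_add_right ip_scale_left ip_scale_right u1
      using wu by (simp add: power2_eq_square algebra_simps)
    have form: "?q ?f = \<mu> + 2 * t * Re (ip V (kop V a u) w) + t\<^sup>2 * ?q w"
      unfolding kop_add[abs_def] kop_scale[abs_def] ip_add_left ip_add_right ip_scale_left
        ip_scale_right \<mu>_def
      using kwu by (simp add: power2_eq_square algebra_simps)
    have re: "Re (ip V w w) = \<mu> * Re (ip V u w) - Re (ip V (kop V a u) w)"
      unfolding ww by simp
    have "0 \<le> \<mu> * Re (ip V ?f ?f) - ?q ?f" using bound[OF f] by simp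
    also have "\<dots> = t * (2 * (\<mu> * Re (ip V u w) - Re (ip V (kop V a u) w)))
        + t\<^sup>2 * (\<mu> * Re (ip V w w) - ?q w)"
      unfolding norm form by (simp add: algebra_simps)
    finally show ?thesis unfolding re .
  qed
  from quadratic_nonneg_imp_linear_zero[OF this] have "Re (ip V w w) = 0" by simp
  hence "ip V w w = 0" by (simp add: ip_self)
  hence "\<forall>v\<in>V. w v = 0" using ip_self_eq_0_iff[OF fin] by blast
  hence "\<forall>v\<in>V. kop V a u v = of_real \<mu> * u v" by (simp add: w_def)
  with uS u1 bound show ?thesis by blast
qed

section \<open>Orthonormal eigenbases and the characteristic polynomial\<close>

definition orthonormal :: "'a set \<Rightarrow> ('a \<Rightarrow> complex) list \<Rightarrow> bool" where
  "orthonormal V us \<longleftrightarrow>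
    (\<forall>i<length us. \<forall>j<length us. ip V (us ! i) (us ! j) = (if i = j then 1 else 0))"

definition eigenfunction :: "'a set \<Rightarrow> ('a \<Rightarrow> 'a \<Rightarrow> real) \<Rightarrow> real \<Rightarrow> ('a \<Rightarrow> complex) \<Rightarrow> bool" where
  "eigenfunction V a d u \<longleftrightarrow> (\<forall>v\<in>V. kop V a u v = of_real d * u v)"

text \<open>Fewer equations than unknowns: the orthogonality conditions are padded with zero rows to
  a square matrix, which is singular because its last row is zero. A kernel vector, read back
  through the numbering \<open>h\<close>, is the function sought.\<close>

lemma exists_nonzero_orthogonal:
  assumes fin: "finite V" and len: "length us < card V"
  shows "\<exists>f v. f \<in> supported_orth V (set us) \<and> v \<in> V \<and> f v \<noteq> 0"
proof -
  define n where "n = card V"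
  obtain h where h: "bij_betw h V {0..<n}"
    using ex_bij_betw_finite_nat[OF fin] by (auto simp: n_def)
  define k where "k = inv_into V h"
  have k: "bij_betw k {0..<n} V" using h by (simp add: k_def bij_betw_inv_into)
  have hk: "h (k i) = i" if "i < n" for i
    using h that by (simp add: k_def bij_betw_inv_into_right)
  define M where "M = mat n n (\<lambda>(i, j). if i < length us then cnj ((us ! i) (k j)) else 0)"
  have M: "M \<in> carrier_mat n n" by (simp add: M_def)
  have "n > 0" "length us \<le> n - 1" using len by (auto simp: n_def)
  have "M\<^sup>T *\<^sub>v unit_vec n (n - 1) = 0\<^sub>v n"
    using \<open>n > 0\<close> \<open>length us \<le> n - 1\<close>
    by (intro eq_vecI) (auto simp: M_def)
  moreover have "unit_vec n (n - 1) \<noteq> (0\<^sub>v n :: complex vec)"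
    using \<open>n > 0\<close> by (auto simp: vec_eq_iff)
  ultimately have "\<exists>x. x \<in> carrier_vec n \<and> x \<noteq> 0\<^sub>v n \<and> M\<^sup>T *\<^sub>v x = 0\<^sub>v n"
    by (intro exI[of _ "unit_vec n (n - 1)"]) simp
  moreover have "M\<^sup>T \<in> carrier_mat n n" using M by simp
  ultimately have "det (M\<^sup>T) = 0"
    by (metis det_0_iff_vec_prod_zero)
  hence "det M = 0" using det_transpose[OF M] by simp
  then obtain x where x: "x \<in> carrier_vec n" "x \<noteq> 0\<^sub>v n" "M *\<^sub>v x = 0\<^sub>v n"
    using det_0_iff_vec_prod_zero[OF M] by blast
  define f where "f v = (if v \<in> V then x $ h v else 0)" for v
  have "ip V f u = 0" if u: "u \<in> set us" for u
  proof -
    obtain i where i: "i < length us" "u = us ! i"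
      using u by (metis in_set_conv_nth)
    have "ip V f u = (\<Sum>j=0..<n. f (k j) * cnj (u (k j)))"
      unfolding ip_def by (rule sum.reindex_bij_betw[OF k, symmetric])
    also have "\<dots> = (\<Sum>j=0..<n. cnj ((us ! i) (k j)) * x $ j)"
      using bij_betwE[OF k] hk by (intro sum.cong) (auto simp: f_def i)
    also have "\<dots> = (M *\<^sub>v x) $ i"
      using i(1) len x(1) by (auto simp: M_def scalar_prod_def n_def)
    also have "\<dots> = 0" using x(3) i(1) len by (simp add: n_def)
    finally show ?thesis .
  qed
  moreover obtain j where j: "j < n" "x $ j \<noteq> 0"
    using x(1,2) by (auto simp: vec_eq_iff)
  moreover have "k j \<in> V" using bij_betwE[OF k] j by auto
  ultimately show ?thesis
    using hk[OF j(1)] by (intro exI[of _ f] exI[of _ "k j"]) (auto simp: f_def supported_orth_def)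
qed

lemma orthonormal_append:
  assumes "orthonormal V us" "ip V u u = 1" "\<forall>w\<in>set us. ip V u w = 0"
  shows "orthonormal V (us @ [u])"
proof -
  have "ip V w u = 0" if "w \<in> set us" for w
    using assms(3) that by (metis ip_cnj complex_cnj_zero)
  thus ?thesis using assms by (auto simp: orthonormal_def nth_append less_Suc_eq)
qed

text \<open>The spectral theorem, started from a prescribed list so that eigenfunctions already
  known become part of the basis. By self-adjointness the orthogonal complement of eigenfunctions is
  invariant, hence contains a further eigenfunction.\<close>

lemma orthonormal_eigenfunctions_extend:
  assumes fin: "finite V"
    and sym: "\<And>v w. v \<in> V \<Longrightarrow> w \<in> V \<Longrightarrow> a v w = a w v"
  shows "orthonormal V us \<Longrightarrow> list_all2 (eigenfunction V a) ds us \<Longrightarrow> length us \<le> card V \<Longrightarrow>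
    \<exists>us' ds'. orthonormal V (us @ us') \<and> list_all2 (eigenfunction V a) (ds @ ds') (us @ us') \<and>
      length (us @ us') = card V"
proof (induction "card V - length us" arbitrary: us ds)
  case 0
  thus ?case by (intro exI[of _ "[]"]) simp
next
  case (Suc m)
  have "length us < card V" using Suc.hyps(2) by simp
  then obtain f v where f: "f \<in> supported_orth V (set us)" "v \<in> V" "f v \<noteq> 0"
    using exists_nonzero_orthogonal[OF fin] by blast
  have "ip V (kop V a g) u = 0" if g: "g \<in> supported_orth V (set us)" and u: "u \<in> set us" for g u
  proof -
    obtain d where "eigenfunction V a d u"
      using Suc.prems(2) u by (metis in_set_conv_nth list_all2_conv_all_nth)
    hence "ip V g (kop V a u) = ip V g (\<lambda>v. of_real d * u v)"
      by (intro ip_cong) (auto simp: eigenfunction_def)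
    also have "\<dots> = 0" using g u by (simp add: ip_scale_right supported_orth_def)
    finally show ?thesis using kop_adjoint[where V = V and a = a and f = g and g = u, OF sym] by simp
  qed
  from top_eigenfunction[OF fin sym this f] obtain \<mu> u
    where u: "u \<in> supported_orth V (set us)" "ip V u u = 1"
      "\<forall>v\<in>V. kop V a u v = of_real \<mu> * u v" by blast
  have "orthonormal V (us @ [u])"
    using u Suc.prems(1) by (intro orthonormal_append) (auto simp: supported_orth_def)
  moreover have "list_all2 (eigenfunction V a) (ds @ [\<mu>]) (us @ [u])"
    using Suc.prems(2) u(3) by (intro list_all2_appendI) (auto simp: eigenfunction_def)
  ultimately have "\<exists>us' ds'. orthonormal V ((us @ [u]) @ us') \<and>
      list_all2 (eigenfunction V a) ((ds @ [\<mu>]) @ ds') ((us @ [u]) @ us') \<and>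
      length ((us @ [u]) @ us') = card V"
    using Suc.hyps(2) by (intro Suc.hyps(1)) auto
  thus ?case by (metis append_assoc)
qed

text \<open>Diagonalisation over the complex numbers: the eigenfunctions are the columns of
  \<open>U\<close>, and orthonormality makes its conjugate transpose \<open>W\<close> the inverse.
  The identity descends to real polynomials because the coefficients embed injectively.\<close>

lemma char_poly_from_eigenfunctions:
  assumes k: "bij_betw k {0..<n} V"
    and on: "orthonormal V us" and ev: "list_all2 (eigenfunction V a) ds us" and len: "length us = n"
  shows "char_poly (mat n n (\<lambda>(i, j). a (k i) (k j))) = (\<Prod>d\<leftarrow>ds. [:- d, 1:])"
proof -
  let ?A = "mat n n (\<lambda>(i, j). a (k i) (k j))"
  let ?B = "map_mat complex_of_real ?A"
  define U where "U = mat n n (\<lambda>(i, j). (us ! j) (k i))"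
  define W where "W = mat n n (\<lambda>(i, j). cnj ((us ! i) (k j)))"
  define D where "D = mat n n (\<lambda>(i, j). if i = j then complex_of_real (ds ! i) else 0)"
  have car: "?B \<in> carrier_mat n n" "U \<in> carrier_mat n n" "W \<in> carrier_mat n n" "D \<in> carrier_mat n n"
    by (simp_all add: U_def W_def D_def)
  have lends: "length ds = n" using ev len by (simp add: list_all2_lengthD)
  have WU: "W * U = 1\<^sub>m n"
  proof (rule eq_matI)
    fix i j assume ij: "i < dim_row (1\<^sub>m n :: complex mat)" "j < dim_col (1\<^sub>m n :: complex mat)"
    hence "(W * U) $$ (i, j) = (\<Sum>l=0..<n. (us ! j) (k l) * cnj ((us ! i) (k l)))"
      by (auto simp: W_def U_def scalar_prod_def mult.commute)
    also have "\<dots> = ip V (us ! j) (us ! i)"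
      unfolding ip_def by (rule sum.reindex_bij_betw[OF k])
    also have "\<dots> = (1\<^sub>m n) $$ (i, j)"
      using on ij len by (auto simp: orthonormal_def)
    finally show "(W * U) $$ (i, j) = (1\<^sub>m n) $$ (i, j)" .
  qed (simp_all add: W_def U_def)
  hence UW: "U * W = 1\<^sub>m n" using mat_mult_left_right_inverse[OF car(3,2)] by simp
  have BU: "?B * U = U * D"
  proof (rule eq_matI)
    fix i j assume "i < dim_row (U * D)" "j < dim_col (U * D)"
    hence ij: "i < n" "j < n" by (simp_all add: U_def D_def)
    have ki: "k i \<in> V" using bij_betwE[OF k] ij by simp
    have "(?B * U) $$ (i, j) = (\<Sum>l=0..<n. of_real (a (k i) (k l)) * (us ! j) (k l))"
      using ij by (auto simp: U_def scalar_prod_def)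
    also have "\<dots> = kop V a (us ! j) (k i)"
      unfolding kop_def by (rule sum.reindex_bij_betw[OF k])
    also have "\<dots> = of_real (ds ! j) * (us ! j) (k i)"
      using ev ki ij len by (auto simp: list_all2_conv_all_nth eigenfunction_def)
    also have "\<dots> = (\<Sum>l=0..<n. if l = j then (us ! l) (k i) * of_real (ds ! l) else 0)"
      using ij by (simp add: mult.commute)
    also have "\<dots> = (\<Sum>l=0..<n. (us ! l) (k i) * (if l = j then of_real (ds ! l) else 0))"
      by (rule sum.cong) simp_all
    also have "\<dots> = (U * D) $$ (i, j)"
      using ij by (simp add: U_def D_def scalar_prod_def)
    finally show "(?B * U) $$ (i, j) = (U * D) $$ (i, j)" .
  qed (simp_all add: U_def D_def)
  have "?B = ?B * (U * W)" using UW car by simp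
  also have "\<dots> = U * D * W"
    using BU assoc_mult_mat[OF car(1-3)] by simp
  finally have "similar_mat_wit ?B D U W"
    using car UW WU by (intro similar_mat_witI) auto
  hence "char_poly ?B = char_poly D"
    by (intro char_poly_similar) (auto simp: similar_mat_def)
  also have "\<dots> = (\<Prod>d\<leftarrow>diag_mat D. [:- d, 1:])"
    using char_poly_upper_triangular[OF car(4)] by (auto simp: upper_triangular_def D_def)
  also have "diag_mat D = map complex_of_real ds"
    using lends by (auto simp: diag_mat_def D_def intro!: nth_equalityI)
  finally have "char_poly ?B = (\<Prod>d\<leftarrow>map complex_of_real ds. [:- d, 1:])" .
  moreover have "map_poly complex_of_real (\<Prod>d\<leftarrow>ds. [:- d, 1:])
      = (\<Prod>d\<leftarrow>map complex_of_real ds. [:- d, 1:])"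
  proof (induction ds)
    case (Cons d ds)
    have b: "map_poly complex_of_real [:- d, 1:] = [:- of_real d, 1:]"
      by (simp add: map_poly_pCons)
    have "map_poly complex_of_real (\<Prod>d\<leftarrow>d # ds. [:- d, 1:]) =
      map_poly complex_of_real [:- d, 1:] * map_poly complex_of_real (\<Prod>d\<leftarrow>ds. [:- d, 1:])"
      unfolding list.map prod_list.Cons
      by (rule poly_eqI) (simp only: coeff_mult coeff_map_poly of_real_0 of_real_sum of_real_mult)
    thus ?case using Cons b by simp
  qed simp
  ultimately have "map_poly complex_of_real (char_poly ?A)
      = map_poly complex_of_real (\<Prod>d\<leftarrow>ds. [:- d, 1:])"
    using of_real_hom.char_poly_hom[of ?A n, where ?'a = complex] by simp
  thus ?thesis by (simp add: poly_eq_iff coeff_map_poly)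
qed

section \<open>From linear factors to the second eigenvalue\<close>

lemma proots_linear_factors: "proots (\<Prod>d\<leftarrow>ds. [:- d, 1:]) = mset (ds :: real list)"
proof (induction ds)
  case (Cons d ds)
  have "(\<Prod>d\<leftarrow>ds. [:- d, 1:]) \<noteq> 0" by auto
  hence "proots (\<Prod>d\<leftarrow>d # ds. [:- d, 1:]) = proots [:- d, 1:] + proots (\<Prod>d\<leftarrow>ds. [:- d, 1:])"
    unfolding list.map prod_list.Cons by (intro proots_mult) auto
  thus ?case using Cons by simp
qed simp

text \<open>If the second entry exceeded \<open>\<mu>\<close>, so would the first; if it were
  smaller, only the first could equal \<open>\<mu>\<close>.\<close>

lemma second_entry_of_descending:
  fixes xs :: "real list"
  assumes desc: "sorted_wrt (\<ge>) xs"
    and one: "length (filter (\<lambda>x. x > \<mu>) xs) \<le> 1"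
    and two: "length (filter (\<lambda>x. x = \<mu>) xs) \<ge> 2"
  shows "xs ! 1 = \<mu>"
proof -
  have "length xs \<ge> 2" using two le_trans length_filter_le by blast
  then obtain x y zs where xs: "xs = x # y # zs"
    by (cases xs; cases "tl xs") auto
  have "\<not> y > \<mu>" using one desc by (auto simp: xs split: if_splits)
  moreover have "\<not> y < \<mu>"
  proof
    assume "y < \<mu>"
    hence "filter (\<lambda>x. x = \<mu>) (y # zs) = []"
      using desc by (auto simp: xs filter_empty_conv)
    thus False using two by (auto simp: xs split: if_splits)
  qed
  ultimately show ?thesis by (simp add: xs)
qed

text \<open>Counts of entries depend only on the multiset of roots, so the eigenvalues
  \<open>ds\<close> may come in any order, as an eigenbasis delivers them.\<close>

lemma second_eigenvalue_multiplicity_ge: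
  assumes G: "pair_graph G"
    and cp: "char_poly (adjacency_mat G) = (\<Prod>d\<leftarrow>ds. [:- d, 1:])"
    and one: "length (filter (\<lambda>d. d > \<mu>) ds) \<le> 1"
    and r: "length (filter (\<lambda>d. d = \<mu>) ds) \<ge> r" "r \<ge> 2"
  shows "second_eigenvalue_multiplicity G \<ge> r"
proof -
  let ?xs = "eigenvalue_list G"
  have mset: "mset ?xs = mset ds"
    by (simp add: eigenvalue_list_def cp proots_linear_factors)
  have len: "length ?xs = card (pverts G)" by (rule length_eigenvalue_list[OF G])
  have filt: "length (filter P ?xs) = length (filter P ds)" for P
    by (metis mset mset_filter size_mset)
  have "sorted_wrt (\<ge>) ?xs"
    by (simp add: eigenvalue_list_def sorted_wrt_rev)
  hence snd: "?xs ! 1 = \<mu>"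
    using one r by (intro second_entry_of_descending) (auto simp: filt)
  have "{j \<in> {1..card (pverts G)}. nth_eigenvalue G j = nth_eigenvalue G 2}
      = Suc ` {i. i < length ?xs \<and> ?xs ! i = \<mu>}"
  proof (intro equalityI subsetI)
    fix j assume "j \<in> {j \<in> {1..card (pverts G)}. nth_eigenvalue G j = nth_eigenvalue G 2}"
    thus "j \<in> Suc ` {i. i < length ?xs \<and> ?xs ! i = \<mu>}"
      using snd len by (intro image_eqI[of _ _ "j - 1"]) (auto simp: nth_eigenvalue_def)
  qed (use snd len in \<open>auto simp: nth_eigenvalue_def\<close>)
  hence "second_eigenvalue_multiplicity G = card {i. i < length ?xs \<and> ?xs ! i = \<mu>}"
    by (simp add: second_eigenvalue_multiplicity_def card_image)
  also have "\<dots> = length (filter (\<lambda>d. d = \<mu>) ds)"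
    unfolding filt[symmetric] by (simp only: length_filter_conv_card)
  finally show ?thesis using r by simp
qed

section \<open>Graphs with relabelled vertices\<close>

text \<open>The construction lives on triples, whereas the theorem asks for vertices in
  \<open>nat\<close>, whose order numbers the rows of \<open>adjacency_mat\<close>.\<close>

definition relabel :: "('a \<Rightarrow> 'b) \<Rightarrow> 'a set \<Rightarrow> 'a rel \<Rightarrow> 'b pair_pre_digraph" where
  "relabel h V E = \<lparr> pverts = h ` V, parcs = map_prod h h ` E \<rparr>"

definition adj :: "'a rel \<Rightarrow> 'a \<Rightarrow> 'a \<Rightarrow> real" where
  "adj E v w = (if (v, w) \<in> E then 1 else 0)"

locale relabelled_graph =
  fixes V :: "'a set" and E :: "'a rel" and h :: "'a \<Rightarrow> nat"
  assumes finite_V: "finite V"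
    and E_subset: "E \<subseteq> V \<times> V"
    and sym_E: "sym E"
    and irrefl_E: "irrefl E"
    and bij_h: "bij_betw h V {0..<card V}"
begin

abbreviation "G \<equiv> relabel h V E"

lemma pverts_G: "pverts G = {0..<card V}"
  using bij_h by (simp add: relabel_def bij_betw_imp_surj_on)

lemma inj_h: "inj_on h V"
  using bij_h by (rule bij_betw_imp_inj_on)

lemma parcs_G_iff: "u \<in> V \<Longrightarrow> w \<in> V \<Longrightarrow> (h u, h w) \<in> parcs G \<longleftrightarrow> (u, w) \<in> E"
proof
  assume uw: "u \<in> V" "w \<in> V" and "(h u, h w) \<in> parcs G"
  then obtain u' w' where *: "(u', w') \<in> E" "h u = h u'" "h w = h w'"
    by (auto simp: relabel_def)
  hence "u = u'" "w = w'" using inj_onD[OF inj_h] uw E_subset by blast+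
  thus "(u, w) \<in> E" using * by simp
qed (auto simp: relabel_def)

lemma pair_graph_G: "pair_graph G"
proof
  show "finite (pverts G)" using finite_V by (simp add: relabel_def)
  show "finite (parcs G)"
    using finite_subset[OF E_subset] finite_V by (simp add: relabel_def)
  show "symmetric G"
    unfolding symmetric_def
    using sym_E by (auto simp: relabel_def sym_def)
  show "fst e \<noteq> snd e" if e: "e \<in> parcs G" for e
  proof -
    obtain u w where uw: "(u, w) \<in> E" "e = (h u, h w)" using e by (auto simp: relabel_def)
    moreover have "u \<noteq> w" using uw irrefl_E by (auto simp: irrefl_def)
    moreover have "u \<in> V" "w \<in> V" using uw E_subset by auto
    ultimately show ?thesis using inj_onD[OF inj_h] by auto
  qed
qed (use E_subset in \<open>auto simp: relabel_def\<close>)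

lemma out_degree_G:
  assumes u: "u \<in> V"
  shows "out_degree (with_proj G) (h u) = card (E `` {u})"
proof -
  have "out_arcs (with_proj G) (h u) = (\<lambda>w. (h u, h w)) ` (E `` {u})"
  proof (intro equalityI subsetI)
    fix e assume "e \<in> out_arcs (with_proj G) (h u)"
    then obtain u' w where *: "(u', w) \<in> E" "e = (h u', h w)" "h u' = h u"
      by (auto simp: out_arcs_def relabel_def)
    hence "u' = u" using inj_onD[OF inj_h] u E_subset by blast
    thus "e \<in> (\<lambda>w. (h u, h w)) ` (E `` {u})" using * by auto
  qed (auto simp: out_arcs_def relabel_def)
  moreover have "inj_on h (E `` {u})"
    by (rule inj_on_subset[OF inj_h]) (use E_subset in auto)
  hence "inj_on (\<lambda>w. (h u, h w)) (E `` {u})"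
    by (auto simp: inj_on_def)
  ultimately show ?thesis by (simp add: out_degree_def card_image)
qed

lemma max_degree_G:
  assumes "\<And>u. u \<in> V \<Longrightarrow> card (E `` {u}) \<le> d" and "u0 \<in> V" "card (E `` {u0}) = d"
  shows "max_degree G = d"
proof -
  have "out_degree (with_proj G) ` pverts G = (\<lambda>u. card (E `` {u})) ` V"
    using out_degree_G by (auto simp: relabel_def image_iff)
  thus ?thesis
    unfolding max_degree_def using assms finite_V by (intro Max_eqI) auto
qed

lemma connected_G:
  assumes u0: "u0 \<in> V" and reach: "\<And>u. u \<in> V \<Longrightarrow> (u, u0) \<in> E\<^sup>*"
  shows "Digraph_Component.connected (with_proj G)"
proof -
  interpret pair_graph G by (rule pair_graph_G)
  have lift: "(h u, h w) \<in> (parcs G)\<^sup>*" if "(u, w) \<in> E\<^sup>*" for u w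
    using that
  proof induction
    case (step w x)
    hence "(h w, h x) \<in> parcs G" by (auto simp: relabel_def)
    with step.IH show ?case by (rule rtrancl.rtrancl_into_rtrancl)
  qed simp
  have "strongly_connected (with_proj (mk_symmetric (with_proj G)))"
  proof (rule strongly_connectedI)
    show "verts (with_proj (mk_symmetric (with_proj G))) \<noteq> {}"
      using u0 by (auto simp: relabel_def)
    fix x y
    assume "x \<in> verts (with_proj (mk_symmetric (with_proj G)))"
      "y \<in> verts (with_proj (mk_symmetric (with_proj G)))"
    then obtain u w where uw: "u \<in> V" "w \<in> V" "x = h u" "y = h w"
      by (auto simp: relabel_def)
    have "(u0, w) \<in> E\<^sup>*" using reach[OF uw(2)] sym_E by (metis sym_rtrancl symE)
    hence "(u, w) \<in> E\<^sup>*" using reach[OF uw(1)] by simp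
    hence "x \<rightarrow>\<^sup>*\<^bsub>with_proj G\<^esub> y"
      unfolding reachable_conv using lift uw by (auto simp: relabel_def)
    thus "x \<rightarrow>\<^sup>*\<^bsub>with_proj (mk_symmetric (with_proj G))\<^esub> y"
      by (rule reachable_mk_symmetricI)
  qed
  thus ?thesis by (simp add: connected_def)
qed

text \<open>Completing \<open>us\<close> to an eigenbasis adds eigenfunctions about which nothing is
  known. Therefore \<open>top\<close> is phrased for arbitrary orthonormal pairs: it then excludes
  two entries of the completed list above \<open>\<mu>\<close>.\<close>

lemma second_eigenvalue_multiplicity_G:
  assumes on: "orthonormal V us" and ev: "\<And>u. u \<in> set us \<Longrightarrow> eigenfunction V (adj E) \<mu> u"
    and len: "2 \<le> length us" "length us \<le> card V"
    and top: "\<And>d e u w. eigenfunction V (adj E) d u \<Longrightarrow> eigenfunction V (adj E) e w \<Longrightarrow>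
      \<mu> < d \<Longrightarrow> \<mu> < e \<Longrightarrow> ip V u w = 0 \<Longrightarrow> ip V u u = 1 \<Longrightarrow> ip V w w = 1 \<Longrightarrow> False"
  shows "length us \<le> second_eigenvalue_multiplicity G"
proof -
  define k where "k = inv_into V h"
  define n where "n = card V"
  have k: "bij_betw k {0..<n} V" using bij_h by (simp add: k_def n_def bij_betw_inv_into)
  have hk: "h (k i) = i" if "i < n" for i
    using bij_h that by (simp add: k_def n_def bij_betw_inv_into_right)
  have sym: "adj E v w = adj E w v" for v w
    using sym_E by (auto simp: adj_def dest: symD)
  have "list_all2 (eigenfunction V (adj E)) (replicate (length us) \<mu>) us"
    using ev by (simp add: list_all2_conv_all_nth)
  then obtain us' ds' where on': "orthonormal V (us @ us')"
    and ev': "list_all2 (eigenfunction V (adj E)) (replicate (length us) \<mu> @ ds') (us @ us')"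
    and len': "length (us @ us') = n"
    using orthonormal_eigenfunctions_extend[where a = "adj E", OF finite_V sym on _ len(2)]
    unfolding n_def by blast
  let ?ds = "replicate (length us) \<mu> @ ds'"
  have lends: "length ?ds = n" using ev' len' by (metis list_all2_lengthD)
  have "adjacency_mat G = mat n n (\<lambda>(i, j). adj E (k i) (k j))"
  proof (rule eq_matI)
    fix i j assume "i < dim_row (mat n n (\<lambda>(i, j). adj E (k i) (k j)))"
      "j < dim_col (mat n n (\<lambda>(i, j). adj E (k i) (k j)))"
    hence ij: "i < n" "j < n" by simp_all
    have "k i \<in> V" "k j \<in> V" using bij_betwE[OF k] ij by simp_all
    hence "(i, j) \<in> parcs G \<longleftrightarrow> (k i, k j) \<in> E"
      using parcs_G_iff[of "k i" "k j"] hk ij by simp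
    thus "adjacency_mat G $$ (i, j) = mat n n (\<lambda>(i, j). adj E (k i) (k j)) $$ (i, j)"
      using ij by (simp add: adjacency_mat_def Let_def pverts_G n_def adj_def)
  qed (simp_all add: adjacency_mat_def Let_def pverts_G n_def)
  hence cp: "char_poly (adjacency_mat G) = (\<Prod>d\<leftarrow>?ds. [:- d, 1:])"
    using char_poly_from_eigenfunctions[OF k on' ev' len'] by simp
  have "card {i. i < n \<and> ?ds ! i > \<mu>} \<le> 1"
  proof (rule ccontr)
    assume "\<not> card {i. i < n \<and> ?ds ! i > \<mu>} \<le> 1"
    then obtain i j where ij: "i < n" "j < n" "?ds ! i > \<mu>" "?ds ! j > \<mu>" "i \<noteq> j"
      using card_le_Suc0_iff_eq[of "{i. i < n \<and> ?ds ! i > \<mu>}"] by auto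
    have evs: "eigenfunction V (adj E) (?ds ! l) ((us @ us') ! l)" if "l < n" for l
      using ev' lends that by (simp only: list_all2_conv_all_nth)
    have ips: "ip V ((us @ us') ! l) ((us @ us') ! m) = (if l = m then 1 else 0)"
      if "l < n" "m < n" for l m
      using on' len' that unfolding orthonormal_def by blast
    show False
      by (rule top[OF evs[OF ij(1)] evs[OF ij(2)] ij(3,4)]) (use ips ij in auto)
  qed
  hence one: "length (filter (\<lambda>d. d > \<mu>) ?ds) \<le> 1"
    using lends by (simp only: length_filter_conv_card)
  have "length (filter (\<lambda>d. d = \<mu>) ?ds) \<ge> length us" by simp
  from second_eigenvalue_multiplicity_ge[OF pair_graph_G cp one this len(1)] show ?thesis .
qed

end

section \<open>Weighted paths\<close>

text \<open>Maximum principle: at a vertex where the ratio of \<open>cmod (w s)\<close> to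
  \<open>y s\<close> is largest, \<open>sub\<close> and \<open>super\<close> together give d <=
  \<nu> unless that ratio is zero. The extra term at 0 is the loop left by the matching.\<close>

lemma weighted_path_supersolution:
  fixes w :: "nat \<Rightarrow> complex" and y c :: "nat \<Rightarrow> real" and d \<nu> :: real
  assumes y: "\<And>s. s < L \<Longrightarrow> y s > 0" and c: "\<And>s. c s \<ge> 0"
    and super: "\<And>s. s < L \<Longrightarrow>
      (if s + 1 < L then c s * y (s + 1) else 0) + (if s > 0 then c (s - 1) * y (s - 1) else 0)
      + (if s = 0 then y 0 else 0) \<le> \<nu> * y s"
    and sub: "\<And>s. s < L \<Longrightarrow> d * cmod (w s) \<le>
      (if s + 1 < L then c s * cmod (w (s + 1)) else 0)
      + (if s > 0 then c (s - 1) * cmod (w (s - 1)) else 0)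
      + (if s = 0 then cmod (w 0) else 0)"
    and d: "d > \<nu>" and s: "s < L"
  shows "w s = 0"
proof (rule ccontr)
  assume nz: "w s \<noteq> 0"
  let ?R = "(\<lambda>s. cmod (w s) / y s) ` {..<L}"
  define R where "R = Max ?R"
  have "R \<in> ?R" unfolding R_def using s by (intro Max_in) auto
  then obtain t where t: "t < L" "R = cmod (w t) / y t" by auto
  have le: "cmod (w s) \<le> R * y s" if "s < L" for s
  proof -
    have "cmod (w s) / y s \<le> R" unfolding R_def using that by (intro Max_ge) auto
    thus ?thesis using y[OF that] by (simp add: pos_divide_le_eq)
  qed
  have "0 < cmod (w s) / y s" using nz y[OF s] by simp
  also have "\<dots> \<le> R" unfolding R_def using s by (intro Max_ge) auto
  finally have R: "R > 0" .
  have "d * (R * y t) = d * cmod (w t)" using t y[OF t(1)] by simp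
  also have "\<dots> \<le> (if t + 1 < L then c t * cmod (w (t + 1)) else 0)
      + (if t > 0 then c (t - 1) * cmod (w (t - 1)) else 0)
      + (if t = 0 then cmod (w 0) else 0)" by (rule sub[OF t(1)])
  also have "\<dots> \<le> (if t + 1 < L then c t * (R * y (t + 1)) else 0)
      + (if t > 0 then c (t - 1) * (R * y (t - 1)) else 0)
      + (if t = 0 then R * y 0 else 0)"
    using t(1) by (auto intro!: add_mono mult_left_mono le c)
  also have "\<dots> = R * ((if t + 1 < L then c t * y (t + 1) else 0)
      + (if t > 0 then c (t - 1) * y (t - 1) else 0)
      + (if t = 0 then y 0 else 0))"
    by (simp add: algebra_simps)
  also have "\<dots> \<le> R * (\<nu> * y t)"
    using R by (intro mult_left_mono super t(1)) auto
  finally have "d * (R * y t) \<le> \<nu> * (R * y t)" by (simp add: algebra_simps)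
  moreover have "R * y t > 0" using R y[OF t(1)] by simp
  ultimately show False using d by (simp add: mult_le_cancel_right)
qed

section \<open>Sine profiles on a path with one weak edge\<close>

lemma sin_step: "sin ((x + 1) * \<theta>) + sin ((x - 1) * \<theta>) = 2 * cos \<theta> * sin (x * \<theta>)" for x \<theta> :: real
  by (simp add: algebra_simps sin_add sin_diff)

text \<open>By the triple-angle formula the quotient sin(3 \<theta>) / sin \<theta> is 3 - 4 (sin
  \<theta>)^2, at least 5/2 in this range, and sqrt 2 - 1 is at least 2/5.\<close>

lemma sin_three_ge:
  fixes \<theta> :: real
  assumes "0 \<le> \<theta>" "\<theta> \<le> 1 / 3"
  shows "sin \<theta> \<le> (sqrt 2 - 1) * sin (3 * \<theta>)"
proof -
  define s where "s = sin \<theta>"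
  have s: "0 \<le> s" "s \<le> 1 / 3"
    using assms sin_x_le_x[of \<theta>] pi_ge_two by (auto simp: s_def intro!: sin_ge_zero)
  have sin3: "sin (3 * \<theta>) = s * (3 - 4 * s\<^sup>2)"
  proof -
    have "sin (3 * \<theta>) = sin (2 * \<theta>) * cos \<theta> + cos (2 * \<theta>) * sin \<theta>"
      using sin_add[of "2 * \<theta>" \<theta>] by simp
    also have "\<dots> = 2 * s * (cos \<theta>)\<^sup>2 + (1 - 2 * s\<^sup>2) * s"
      by (simp add: sin_double cos_double_sin s_def power2_eq_square)
    also have "(cos \<theta>)\<^sup>2 = 1 - s\<^sup>2" by (simp add: s_def cos_squared_eq)
    finally show ?thesis by (simp add: algebra_simps power2_eq_square)
  qed
  have "s\<^sup>2 \<le> (1 / 3)\<^sup>2" using s by (intro power_mono) auto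
  hence "3 - 4 * s\<^sup>2 \<ge> 5 / 2" by (simp add: power2_eq_square)
  moreover have "sqrt 2 - 1 \<ge> (2 / 5 :: real)"
    using real_le_rsqrt[of "7 / 5" 2] by (simp add: power2_eq_square)
  ultimately have "2 / 5 * (5 / 2) \<le> (sqrt 2 - 1) * (3 - 4 * s\<^sup>2)"
    by (intro mult_mono) auto
  hence "s * 1 \<le> s * ((sqrt 2 - 1) * (3 - 4 * s\<^sup>2))"
    using s by (intro mult_left_mono) auto
  also have "\<dots> = (sqrt 2 - 1) * sin (3 * \<theta>)" unfolding sin3 by (simp only: mult.left_commute)
  finally show ?thesis by (simp add: s_def)
qed

text \<open>One step along the profile changes the sine by at most sin \<theta>, and at distance at
  least 3 \<theta> from the zeros 0 and pi this is at most the fraction sqrt 2 - 1 of the value. The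
  bounds on \<open>m\<close> provide that distance; \<open>L >= 12\<close> with pi < 4 gives
  \<theta> <= 1/3.\<close>

lemma sin_ratio:
  fixes m L :: nat
  assumes L: "L \<ge> 12" and m: "2 \<le> m" "m + 4 \<le> L"
  shows "sin (real m * (pi / L)) \<le> sqrt 2 * sin (real (m + 1) * (pi / L))"
proof -
  define \<theta> where "\<theta> = pi / L"
  have \<theta>: "0 < \<theta>" "\<theta> \<le> 1 / 3" "real L * \<theta> = pi"
    using L pi_less_4 by (auto simp: \<theta>_def field_simps)
  define z where "z = pi - real (m + 1) * \<theta>"
  have z: "3 * \<theta> \<le> z" "z \<le> pi - 3 * \<theta>"
  proof -
    have "(real (m + 4)) * \<theta> \<le> real L * \<theta>" using m \<theta> by (intro mult_right_mono) auto
    thus "3 * \<theta> \<le> z" using \<theta>(3) by (simp add: z_def algebra_simps)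
    have "3 * \<theta> \<le> real (m + 1) * \<theta>" using m \<theta> by (intro mult_right_mono) auto
    thus "z \<le> pi - 3 * \<theta>" by (simp add: z_def)
  qed
  have sin3: "sin (3 * \<theta>) \<le> sin z"
  proof (cases "z \<le> pi / 2")
    case True
    thus ?thesis using z \<theta> by (intro sin_monotone_2pi_le) auto
  next
    case False
    have "sin (3 * \<theta>) \<le> sin (pi - z)"
      using z \<theta> False by (intro sin_monotone_2pi_le) auto
    thus ?thesis by simp
  qed
  have sz: "sin z \<ge> 0" using z \<theta> by (intro sin_ge_zero) auto
  have "sin (real m * \<theta>) = sin (pi - (z + \<theta>))" by (simp add: z_def algebra_simps)
  also have "\<dots> = sin z * cos \<theta> + cos z * sin \<theta>" by (simp add: sin_add)
  also have "\<dots> \<le> sin z * 1 + 1 * sin \<theta>"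
    using sz sin_ge_zero[of \<theta>] \<theta> pi_ge_two by (intro add_mono mult_left_mono mult_right_mono) auto
  also have "\<dots> \<le> sin z + (sqrt 2 - 1) * sin (3 * \<theta>)"
    using sin_three_ge[of \<theta>] \<theta> by simp
  also have "\<dots> \<le> sin z + (sqrt 2 - 1) * sin z"
    using sin3 by (intro add_left_mono mult_left_mono) auto
  also have "\<dots> = sqrt 2 * sin z" by (simp add: algebra_simps)
  also have "sin z = sin (real (m + 1) * \<theta>)" by (simp add: z_def)
  finally show ?thesis by (simp add: \<theta>_def)
qed

text \<open>A supersolution made of two sine arcs of frequency pi/L, with a kink at the weak edge
  from \<open>b\<close> to \<open>b + 1\<close>. With all weights 2 a single arc vanishing at -2 and
  at L would have the smaller frequency pi/(L+2); the weak edge pays for the difference. The margins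
  3 and 6 around \<open>b\<close> are what \<open>sin_ratio\<close> needs on both sides.\<close>

lemma weighted_path_no_large_eigenvalue:
  fixes w :: "nat \<Rightarrow> complex" and c :: "nat \<Rightarrow> real" and d :: real
  assumes L: "L \<ge> 12" and c: "\<And>s. c s \<ge> 0" "\<And>s. c s \<le> 2"
    and b: "3 \<le> b" "b + 6 \<le> L" "c b \<le> sqrt 2"
    and sub: "\<And>s. s < L \<Longrightarrow> d * cmod (w s) \<le>
      (if s + 1 < L then c s * cmod (w (s + 1)) else 0)
      + (if s > 0 then c (s - 1) * cmod (w (s - 1)) else 0)
      + (if s = 0 then cmod (w 0) else 0)"
    and d: "d > 4 * cos (pi / L)" and s: "s < L"
  shows "w s = 0"
proof -
  define \<theta> where "\<theta> = pi / L"
  have \<theta>: "0 < \<theta>" "real L * \<theta> = pi" using L by (auto simp: \<theta>_def)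
  have pos: "sin (real m * \<theta>) > 0" if "0 < m" "m < L" for m
  proof (rule sin_gt_zero)
    show "0 < real m * \<theta>" using that \<theta> by simp
    have "real m * \<theta> < real L * \<theta>" using that \<theta> by (intro mult_strict_right_mono) auto
    thus "real m * \<theta> < pi" using \<theta> by simp
  qed
  define A where "A = sin (real (b + 2) * \<theta>)"
  define B where "B = sin (real (L - b - 1) * \<theta>)"
  have AB: "A > 0" "B > 0" unfolding A_def B_def using b by (intro pos; simp)+
  \<comment> \<open>The left arc vanishes only at -2: its value at -1, doubled, then covers the loop
    at 0 because sin(2 \<theta>) <= 2 sin \<theta>. The right arc vanishes at \<open>L\<close>, just
    beyond the path. Dividing by \<open>A\<close> and \<open>B\<close> makes \<open>y\<close> equal
    to 1 at both ends of the weak edge.\<close>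
  define y where "y j = (if j \<le> b then sin (real (j + 2) * \<theta>) / A else sin (real (L - j) * \<theta>) / B)" for j
  have ypos: "y j > 0" if "j < L" for j
  proof (cases "j \<le> b")
    case True
    thus ?thesis using pos[of "j + 2"] AB b by (simp add: y_def del: of_nat_add)
  next
    case False
    thus ?thesis using pos[of "L - j"] AB that by (simp add: y_def of_nat_diff)
  qed
  have stepA: "sin (real (j + 3) * \<theta>) + sin (real (j + 1) * \<theta>) = 2 * cos \<theta> * sin (real (j + 2) * \<theta>)" for j
    using sin_step[of "real (j + 2)" \<theta>] by (simp add: algebra_simps)
  have stepB: "sin (real (L - (j - 1)) * \<theta>) + sin (real (L - (j + 1)) * \<theta>) = 2 * cos \<theta> * sin (real (L - j) * \<theta>)"
    if "0 < j" "j < L" for j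
  proof -
    have "real (L - (j - 1)) = real (L - j) + 1" "real (L - (j + 1)) = real (L - j) - 1"
      using that by (auto simp: of_nat_diff)
    thus ?thesis by (simp only: sin_step)
  qed
  have ratioA: "A \<le> sqrt 2 * sin (real (b + 3) * \<theta>)"
    using sin_ratio[OF L, of "b + 2"] b by (simp add: A_def \<theta>_def add.commute)
  have ratioB: "B \<le> sqrt 2 * sin (real (L - b) * \<theta>)"
  proof -
    have "L - b - 1 + 1 = L - b" using b by simp
    thus ?thesis using sin_ratio[OF L, of "L - b - 1"] b by (simp add: B_def \<theta>_def)
  qed
  have super: "(if s + 1 < L then c s * y (s + 1) else 0) + (if s > 0 then c (s - 1) * y (s - 1) else 0)
      + (if s = 0 then y 0 else 0) \<le> (4 * cos \<theta>) * y s" if s: "s < L" for s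
  proof -
    have c2: "c i * y j \<le> 2 * y j" if "j < L" for i j
      using c ypos[OF that] by (intro mult_right_mono) auto
    have scale: "2 * (p / q) + 2 * (r / q) = 4 * cos \<theta> * (t / q)"
      if "p + r = 2 * cos \<theta> * t" for p q r t :: real
    proof -
      have "2 * (p / q) + 2 * (r / q) = 2 * ((p + r) / q)" by (simp add: add_divide_distrib)
      thus ?thesis by (simp add: that)
    qed
    have r2: "sqrt 2 * (sqrt 2 * x) = 2 * x" for x :: real
      by (simp flip: mult.assoc)
    have yb: "y b = 1" "y (b + 1) = 1"
      using AB by (simp_all add: y_def A_def B_def)
    consider "s = 0" | "0 < s" "s < b" | "s = b" | "s = b + 1" | "b + 1 < s" by linarith
    thus ?thesis
    proof cases
      case 1
      have "sin (2 * \<theta>) \<le> 2 * sin \<theta>"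
      proof -
        have "sin \<theta> > 0" using pos[of 1] L by simp
        hence "sin \<theta> * cos \<theta> \<le> sin \<theta> * 1" by (intro mult_left_mono) auto
        thus ?thesis by (simp add: sin_double)
      qed
      hence "2 * sin (real (0 + 3) * \<theta>) + sin (2 * \<theta>) \<le> 4 * cos \<theta> * sin (2 * \<theta>)"
        using stepA[of 0] by simp
      hence "(2 * sin (3 * \<theta>) + sin (2 * \<theta>)) / A \<le> 4 * cos \<theta> * sin (2 * \<theta>) / A"
        using AB by (intro divide_right_mono) auto
      hence "2 * y 1 + y 0 \<le> 4 * cos \<theta> * y 0"
        using b by (simp add: y_def add_divide_distrib)
      thus ?thesis using 1 L c2[of 1 0] by simp
    next
      case 2
      have "2 * y (s + 1) + 2 * y (s - 1) = 4 * cos \<theta> * y s"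
      proof -
        have "y (s + 1) = sin (real (s + 3) * \<theta>) / A" "y (s - 1) = sin (real (s + 1) * \<theta>) / A"
          "y s = sin (real (s + 2) * \<theta>) / A"
          using 2 by (auto simp: y_def algebra_simps of_nat_diff)
        thus ?thesis using scale[OF stepA[of s]] by (simp only:)
      qed
      thus ?thesis using 2 s b c2[of "s + 1" s] c2[OF less_imp_diff_less[OF s, of 1], of "s - 1"] by auto
    next
      case 3
      \<comment> \<open>Across the weak edge the actual contribution is at most sqrt 2, and by
        \<open>ratioA\<close> the continued left arc with weight 2 would contribute at least as
        much. The next case is the mirror image.\<close>
      have "c b * y (b + 1) \<le> 2 * (sin (real (b + 3) * \<theta>) / A)"
      proof -
        have "sqrt 2 * A \<le> sqrt 2 * (sqrt 2 * sin (real (b + 3) * \<theta>))"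
          using ratioA by (intro mult_left_mono) auto
        hence "sqrt 2 * A \<le> 2 * sin (real (b + 3) * \<theta>)" by (simp only: r2)
        hence "sqrt 2 \<le> 2 * (sin (real (b + 3) * \<theta>) / A)" using AB by (simp add: pos_le_divide_eq)
        thus ?thesis using b yb by simp
      qed
      moreover have "c (b - 1) * y (b - 1) \<le> 2 * (sin (real (b + 1) * \<theta>) / A)"
      proof -
        have "y (b - 1) = sin (real (b + 1) * \<theta>) / A"
          using b by (auto simp: y_def algebra_simps of_nat_diff)
        thus ?thesis using c2[of "b - 1" "b - 1"] b by simp
      qed
      moreover have "2 * (sin (real (b + 3) * \<theta>) / A) + 2 * (sin (real (b + 1) * \<theta>) / A) = 4 * cos \<theta> * y b"
      proof -
        have "y b = sin (real (b + 2) * \<theta>) / A" by (simp add: y_def)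
        thus ?thesis using scale[OF stepA[of b]] by (simp only:)
      qed
      ultimately show ?thesis using 3 b by simp
    next
      case 4
      have "c b * y b \<le> 2 * (sin (real (L - b) * \<theta>) / B)"
      proof -
        have "sqrt 2 * B \<le> sqrt 2 * (sqrt 2 * sin (real (L - b) * \<theta>))"
          using ratioB by (intro mult_left_mono) auto
        hence "sqrt 2 * B \<le> 2 * sin (real (L - b) * \<theta>)" by (simp only: r2)
        hence "sqrt 2 \<le> 2 * (sin (real (L - b) * \<theta>) / B)" using AB by (simp add: pos_le_divide_eq)
        thus ?thesis using b yb by simp
      qed
      moreover have "c (b + 1) * y (b + 2) \<le> 2 * (sin (real (L - (b + 2)) * \<theta>) / B)"
        using c2[of "b + 2" "b + 1"] b by (simp add: y_def)
      moreover have "2 * (sin (real (L - b) * \<theta>) / B) + 2 * (sin (real (L - (b + 2)) * \<theta>) / B)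
          = 4 * cos \<theta> * y (b + 1)"
      proof -
        have "y (b + 1) = sin (real (L - (b + 1)) * \<theta>) / B" by (simp add: y_def)
        thus ?thesis using scale[OF stepB[of "b + 1"]] b by simp
      qed
      ultimately show ?thesis using 4 b by simp
    next
      case 5
      have "y (s - 1) = sin (real (L - (s - 1)) * \<theta>) / B" "y s = sin (real (L - s) * \<theta>) / B"
        "y (s + 1) = sin (real (L - (s + 1)) * \<theta>) / B"
        using 5 by (auto simp: y_def)
      hence eq: "2 * y (s - 1) + 2 * y (s + 1) = 4 * cos \<theta> * y s"
        using scale[OF stepB[of s]] 5 s by simp
      have l1: "c (s - 1) * y (s - 1) \<le> 2 * y (s - 1)" using s by (intro c2) simp
      have "(if s + 1 < L then c s * y (s + 1) else 0) \<le> 2 * y (s + 1)"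
      proof (cases "s + 1 < L")
        case False
        hence "y (s + 1) = 0" using s 5 by (simp add: y_def)
        thus ?thesis using False by simp
      qed (use c2 in simp)
      thus ?thesis using l1 eq 5 by simp
    qed
  qed
  show ?thesis
    by (rule weighted_path_supersolution[where y = y and c = c and \<nu> = "4 * cos \<theta>", OF ypos c(1) super sub])
      (use d s in \<open>simp_all add: \<theta>_def\<close>)
qed

section \<open>The zero frequency: paths with all weights equal to 2\<close>

text \<open>The Chebyshev polynomial of the second kind \<open>U\<^sub>j\<close> at \<open>d / 4\<close>.\<close>

fun cheb :: "real \<Rightarrow> nat \<Rightarrow> real" where
  "cheb d 0 = 1"
| "cheb d (Suc 0) = d / 2"
| "cheb d (Suc (Suc j)) = d / 2 * cheb d (Suc j) - cheb d j"

text \<open>Sturm comparison: quotients of consecutive values dominate those of the sines sin((j+1)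
  \<theta>), which solve the same recurrence at d = 4 cos \<theta> and stay positive up to L - 1.
  The inductive claim is this comparison with denominators cleared; index L - 1 is recovered
  separately from its last instance.\<close>

lemma cheb_nonneg:
  fixes L :: nat
  assumes L: "L \<ge> 2" and d: "d \<ge> 4 * cos (pi / L)" and j: "j < L"
  shows "cheb d j \<ge> 0"
proof -
  define \<theta> where "\<theta> = pi / L"
  have \<theta>: "0 < \<theta>" "real L * \<theta> = pi" using L by (auto simp: \<theta>_def)
  have pos: "sin (real m * \<theta>) > 0" if "0 < m" "m < L" for m
  proof (rule sin_gt_zero)
    show "0 < real m * \<theta>" using that \<theta> by simp
    have "real m * \<theta> < real L * \<theta>" using that \<theta> by (intro mult_strict_right_mono) auto
    thus "real m * \<theta> < pi" using \<theta> by simp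
  qed
  have nonneg: "sin (real m * \<theta>) \<ge> 0" if "m \<le> L" for m
    using pos[of m] \<theta>(2) that by (cases "m = 0 \<or> m = L") auto
  have main: "cheb d j \<ge> 0 \<and> cheb d (Suc j) * sin (real (j + 1) * \<theta>) \<ge> cheb d j * sin (real (j + 2) * \<theta>)"
    if "j + 2 \<le> L" for j
    using that
  proof (induction j)
    case 0
    have "4 * cos \<theta> * sin \<theta> \<le> d * sin \<theta>"
      using d pos[of 1] L by (intro mult_right_mono) (auto simp: \<theta>_def)
    moreover have "4 * cos \<theta> * sin \<theta> = 2 * sin (2 * \<theta>)" by (simp add: sin_double)
    ultimately show ?case by simp
  next
    case (Suc j)
    hence IH: "cheb d j \<ge> 0" "cheb d (Suc j) * sin (real (j + 1) * \<theta>) \<ge> cheb d j * sin (real (j + 2) * \<theta>)"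
      by auto
    have "0 \<le> cheb d j * sin (real (j + 2) * \<theta>)"
      using IH(1) nonneg[of "j + 2"] Suc.prems by simp
    hence "cheb d (Suc j) * sin (real (j + 1) * \<theta>) \<ge> 0" using IH(2) by linarith
    hence Q: "cheb d (Suc j) \<ge> 0"
      using pos[of "j + 1"] Suc.prems by (simp add: zero_le_mult_iff)
    let ?s = "sin (real (j + 2) * \<theta>)"
    have "sin (real (j + 3) * \<theta>) + sin (real (j + 1) * \<theta>) = 2 * cos \<theta> * ?s"
      using sin_step[of "real (j + 2)" \<theta>] by (simp add: algebra_simps)
    hence "sin (real (j + 3) * \<theta>) = 2 * cos \<theta> * ?s - sin (real (j + 1) * \<theta>)"
      by linarith
    hence "cheb d (Suc j) * sin (real (j + 3) * \<theta>)
        = 2 * cos \<theta> * ?s * cheb d (Suc j) - cheb d (Suc j) * sin (real (j + 1) * \<theta>)"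
      by (simp only: right_diff_distrib mult.commute[of "cheb d (Suc j)"])
    also have "\<dots> \<le> d / 2 * ?s * cheb d (Suc j) - cheb d j * ?s"
    proof (rule diff_mono[OF _ IH(2)])
      have "2 * cos \<theta> * (?s * cheb d (Suc j)) \<le> d / 2 * (?s * cheb d (Suc j))"
        using d nonneg[of "j + 2"] Suc.prems Q by (intro mult_right_mono) (auto simp: \<theta>_def)
      thus "2 * cos \<theta> * ?s * cheb d (Suc j) \<le> d / 2 * ?s * cheb d (Suc j)"
        by (simp only: mult.assoc)
    qed
    also have "\<dots> = cheb d (Suc (Suc j)) * ?s" by (simp add: algebra_simps)
    finally show ?case using Q by (simp add: algebra_simps)
  qed
  show ?thesis
  proof (cases "j + 2 \<le> L")
    case False
    then obtain i where "j = Suc i" using j L by (cases j) auto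
    with False j have i: "j = Suc i" "i + 2 = L" by auto
    have "0 \<le> cheb d (Suc i) * sin (real (i + 1) * \<theta>)"
      using main[of i] nonneg[of "i + 2"] i by (smt (verit) mult_nonneg_nonneg order_refl)
    thus ?thesis using pos[of "i + 1"] i by (simp add: zero_le_mult_iff)
  qed (use main in blast)
qed

text \<open>Solving downward from the far end \<open>L - 1\<close> involves only the equations at
  \<open>s > 0\<close> and so keeps clear of the matching in the bottom layer.\<close>

lemma path_eigenfunction_cheb:
  fixes w :: "nat \<Rightarrow> complex"
  assumes eq: "\<And>s. 0 < s \<Longrightarrow> s < L \<Longrightarrow>
      of_real d * w s = (if s + 1 < L then 2 * w (s + 1) else 0) + 2 * w (s - 1)"
  shows "j < L \<Longrightarrow> w (L - 1 - j) = w (L - 1) * of_real (cheb d j)"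
proof (induction j rule: induct_nat_012)
  case 1
  have "of_real d * w (L - 1) = 2 * w (L - 2)"
    using eq[of "L - 1"] 1 by (simp add: numeral_2_eq_2)
  thus ?case by (simp add: numeral_2_eq_2 mult.commute)
next
  case (ge2 j)
  define s where "s = L - 1 - Suc j"
  have s: "0 < s" "s < L" "s + 1 < L" "s + 1 = L - 1 - j" "s - 1 = L - 1 - Suc (Suc j)"
    using ge2(3) by (auto simp: s_def)
  have "of_real d * w s = 2 * w (s + 1) + 2 * w (s - 1)" using eq[OF s(1,2)] s(3) by simp
  moreover have "w s = w (L - 1) * of_real (cheb d (Suc j))" using ge2 by (simp add: s_def)
  moreover have "w (s + 1) = w (L - 1) * of_real (cheb d j)" using ge2 s(4) by simp
  ultimately show ?case using s(5) by (simp add: algebra_simps)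
qed simp

text \<open>Both functions are multiples of nonnegative ones that agree at the far end of the path.\<close>

lemma large_path_eigenfunctions_not_orthogonal:
  fixes w1 w2 :: "nat \<Rightarrow> complex"
  assumes L: "L \<ge> 2" and d: "d1 \<ge> 4 * cos (pi / L)" "d2 \<ge> 4 * cos (pi / L)"
    and eq1: "\<And>s. 0 < s \<Longrightarrow> s < L \<Longrightarrow>
      of_real d1 * w1 s = (if s + 1 < L then 2 * w1 (s + 1) else 0) + 2 * w1 (s - 1)"
    and eq2: "\<And>s. 0 < s \<Longrightarrow> s < L \<Longrightarrow>
      of_real d2 * w2 s = (if s + 1 < L then 2 * w2 (s + 1) else 0) + 2 * w2 (s - 1)"
    and orth: "(\<Sum>s<L. w1 s * cnj (w2 s)) = 0"
  shows "(\<forall>s<L. w1 s = 0) \<or> (\<forall>s<L. w2 s = 0)"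
proof -
  note c1 = path_eigenfunction_cheb[OF eq1] and c2 = path_eigenfunction_cheb[OF eq2]
  have "(\<Sum>s<L. w1 s * cnj (w2 s)) = (\<Sum>j<L. w1 (L - 1 - j) * cnj (w2 (L - 1 - j)))"
    using sum.nat_diff_reindex[of "\<lambda>s. w1 s * cnj (w2 s)" L] by simp
  also have "\<dots> = (\<Sum>j<L. w1 (L - 1) * cnj (w2 (L - 1)) * of_real (cheb d1 j * cheb d2 j))"
  proof (rule sum.cong[OF refl])
    fix j assume "j \<in> {..<L}"
    thus "w1 (L - 1 - j) * cnj (w2 (L - 1 - j))
        = w1 (L - 1) * cnj (w2 (L - 1)) * of_real (cheb d1 j * cheb d2 j)"
      by (simp only: lessThan_iff c1[of j] c2[of j]) simp
  qed
  also have "\<dots> = w1 (L - 1) * cnj (w2 (L - 1)) * of_real (\<Sum>j<L. cheb d1 j * cheb d2 j)"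
    by (simp add: sum_distrib_left)
  finally have "w1 (L - 1) * cnj (w2 (L - 1)) * of_real (\<Sum>j<L. cheb d1 j * cheb d2 j) = 0"
    using orth by simp
  \<comment> \<open>Strict because the far end \<open>j = 0\<close> contributes 1.\<close>
  moreover have "(\<Sum>j<L. cheb d1 j * cheb d2 j) > 0"
  proof (rule sum_pos2[of _ 0])
    show "0 \<le> cheb d1 j * cheb d2 j" if "j \<in> {..<L}" for j
      using that cheb_nonneg[OF L d(1)] cheb_nonneg[OF L d(2)] by simp
  qed (use L in auto)
  ultimately have "w1 (L - 1) = 0 \<or> w2 (L - 1) = 0" by (auto simp del: of_real_sum)
  thus ?thesis
  proof
    assume "w1 (L - 1) = 0"
    moreover have "w1 s = w1 (L - 1) * of_real (cheb d1 (L - 1 - s))" if "s < L" for s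
      using c1[of "L - 1 - s"] that by simp
    ultimately show ?thesis by simp
  next
    assume "w2 (L - 1) = 0"
    moreover have "w2 s = w2 (L - 1) * of_real (cheb d2 (L - 1 - s))" if "s < L" for s
      using c2[of "L - 1 - s"] that by simp
    ultimately show ?thesis by simp
  qed
qed

section \<open>The gap between the top eigenvalues of consecutive paths\<close>

lemma sin_ge_half:
  fixes x :: real
  assumes "0 \<le> x" "x \<le> pi / 3"
  shows "sin x \<ge> x / 2"
proof -
  have "sin 0 - 0 / 2 \<le> sin x - x / 2"
  proof (rule DERIV_nonneg_imp_nondecreasing[OF assms(1)])
    fix t assume t: "0 \<le> t" "t \<le> x"
    have "cos t \<ge> cos (pi / 3)" using t assms by (intro cos_monotone_0_pi_le) auto
    thus "\<exists>y. ((\<lambda>x. sin x - x / 2) has_real_derivative y) (at t) \<and> 0 \<le> y"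
      by (intro exI[of _ "cos t - 1 / 2"]) (auto intro!: derivative_eq_intros simp: cos_60)
  qed
  thus ?thesis by simp
qed

text \<open>The difference of cosines is a product of two sines; bounding each sine below by half
  its argument leaves at least pi^2 / (L (L+1)^2), more than 1/(L+1)^3. \<open>L >= 3\<close> keeps
  the arguments below pi/3, where the sine bound holds.\<close>

lemma cos_pi_gap:
  fixes L :: nat
  assumes L: "L \<ge> 3" and N: "real (L + 1) ^ 3 \<le> N"
  shows "4 * cos (pi / L) < 4 * cos (pi / (L + 1)) - 1 / N"
proof -
  define A where "A = pi / (real L + 1)"
  define B where "B = pi / real L"
  have AB: "0 < A" "A < B" "B \<le> pi / 3"
  proof -
    show "0 < A" using pi_gt_zero by (simp add: A_def add_pos_nonneg)
    show "A < B" unfolding A_def B_def using L by (intro divide_strict_left_mono) auto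
    show "B \<le> pi / 3" unfolding B_def using L by (intro divide_left_mono) auto
  qed
  have "A / 2 \<le> (A + B) / 2 / 2" using AB by simp
  also have "\<dots> \<le> sin ((A + B) / 2)" using AB by (intro sin_ge_half) auto
  finally have s1: "A / 2 \<le> sin ((A + B) / 2)" .
  have s2: "(B - A) / 2 / 2 \<le> sin ((B - A) / 2)" using AB by (intro sin_ge_half) auto
  have "(A / 2) * ((B - A) / 2 / 2) \<le> sin ((A + B) / 2) * sin ((B - A) / 2)"
    using s1 s2 AB by (intro mult_mono) auto
  hence "A * (B - A) \<le> 4 * (2 * sin ((A + B) / 2) * sin ((B - A) / 2))" by simp
  also have "2 * sin ((A + B) / 2) * sin ((B - A) / 2) = cos A - cos B"
    by (simp add: cos_diff_cos)
  finally have *: "A * (B - A) \<le> 4 * cos A - 4 * cos B" by simp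
  have "A * (B - A) = pi\<^sup>2 / (real L * (real L + 1)\<^sup>2)"
  proof -
    have "B - A = pi / (real L * (real L + 1))" using L by (simp add: A_def B_def field_simps)
    thus ?thesis by (simp add: A_def power2_eq_square)
  qed
  also have "\<dots> > 1 / (real (L + 1) ^ 3)"
  proof -
    have "1 < pi\<^sup>2" using pi_ge_two by (intro one_less_power) auto
    moreover have "real L * (real L + 1)\<^sup>2 \<le> real (L + 1) ^ 3"
      by (simp add: power3_eq_cube power2_eq_square algebra_simps)
    ultimately show ?thesis using L by (intro frac_less) (auto intro: add_pos_nonneg)
  qed
  finally have "1 / (real (L + 1) ^ 3) < A * (B - A)" by simp
  moreover have "1 / N \<le> 1 / (real (L + 1) ^ 3)"
    using N by (intro divide_left_mono mult_pos_pos) (auto intro: less_le_trans[rotated])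
  ultimately show ?thesis using * by (simp add: A_def B_def add.commute)
qed

text \<open>The angle of \<open>a / N\<close>, doubled until it first reaches a quarter turn, is at most half a turn.\<close>

lemma exists_doubling_in_left_half:
  fixes a N :: nat
  assumes "0 < a" "a < N"
  shows "\<exists>j. 2 ^ j < N \<and> cos (2 * pi * (real a * 2 ^ j) / real N) \<le> 0"
proof -
  define a' where "a' = min a (N - a)"
  have a': "0 < a'" "2 * a' \<le> N" using assms by (auto simp: a'_def)
  have cos_eq: "cos (2 * pi * (real a * 2 ^ j) / real N) = cos (2 * pi * (real a' * 2 ^ j) / real N)" for j
  proof (cases "a' = a")
    case False
    hence a'N: "real a' = real N - real a" using assms by (auto simp: a'_def of_nat_diff)
    have "2 * pi * (real a' * 2 ^ j) / real N
        = 2 * pi * real (2 ^ j) - 2 * pi * (real a * 2 ^ j) / real N"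
      using assms by (simp add: a'N field_simps)
    also have "cos \<dots> = cos (2 * pi * (real a * 2 ^ j) / real N)"
      using cos_int_2pin[of "2 ^ j"] sin_int_2pin[of "2 ^ j"] by (simp add: cos_diff)
    finally show ?thesis by simp
  qed simp
  have "\<exists>j. N \<le> 4 * a' * 2 ^ j"
  proof
    have "N < 2 ^ N" by (rule less_exp)
    also have "\<dots> \<le> 4 * a' * 2 ^ N" using a' by simp
    finally show "N \<le> 4 * a' * 2 ^ N" by simp
  qed
  define j where "j = (LEAST j. N \<le> 4 * a' * 2 ^ j)"
  have j: "N \<le> 4 * a' * 2 ^ j"
    unfolding j_def by (rule LeastI_ex) fact
  have j2: "2 * a' * 2 ^ j \<le> N"
  proof (cases j)
    case (Suc i)
    hence "\<not> N \<le> 4 * a' * 2 ^ i" using not_less_Least[of i "\<lambda>j. N \<le> 4 * a' * 2 ^ j"] by (simp add: j_def)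
    thus ?thesis using Suc by simp
  qed (use a' in simp)
  have "2 ^ j < 2 * a' * 2 ^ j" using a' by simp
  hence "2 ^ j < N" using j2 by linarith
  moreover have "cos (2 * pi * (real a' * 2 ^ j) / real N) \<le> 0"
  proof -
    define x where "x = 2 * pi * (real a' * 2 ^ j) / real N"
    have N: "real N > 0" using assms by simp
    have r: "real N \<le> 4 * (real a' * 2 ^ j)" "2 * (real a' * 2 ^ j) \<le> real N"
      using of_nat_mono[OF j, where 'a = real] of_nat_mono[OF j2, where 'a = real]
      by (simp_all add: mult.assoc)
    have "pi / 2 * real N \<le> pi / 2 * (4 * (real a' * 2 ^ j))" using r(1) by (intro mult_left_mono) auto
    hence "pi / 2 \<le> x" using N by (simp add: x_def pos_le_divide_eq)
    moreover have "pi * (2 * (real a' * 2 ^ j)) \<le> pi * real N" using r(2) by (intro mult_left_mono) auto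
    hence "x \<le> pi" using N by (simp add: x_def pos_divide_le_eq)
    ultimately have "cos x \<le> cos (pi / 2)" by (intro cos_monotone_0_pi_le) auto
    thus ?thesis by (simp add: x_def)
  qed
  ultimately show ?thesis using cos_eq by auto
qed

section \<open>Fourier analysis on cyclic groups\<close>

definition \<omega> :: "int \<Rightarrow> int \<Rightarrow> complex" where
  "\<omega> N z = cis (2 * pi * of_int z / of_int N)"

lemma \<omega>_add: "\<omega> N (x + y) = \<omega> N x * \<omega> N y"
  by (simp add: \<omega>_def cis_mult add_divide_distrib distrib_left)

lemma \<omega>_0 [simp]: "\<omega> N 0 = 1"
  by (simp add: \<omega>_def)

lemma cnj_\<omega>: "cnj (\<omega> N x) = \<omega> N (- x)"
  by (simp add: \<omega>_def cis_cnj)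

lemma norm_\<omega> [simp]: "cmod (\<omega> N x) = 1"
  by (simp add: \<omega>_def)

lemma \<omega>_eq_1_iff: "N > 0 \<Longrightarrow> \<omega> N x = 1 \<longleftrightarrow> N dvd x"
proof
  assume N: "N > 0" and "\<omega> N x = 1"
  hence "cos (2 * pi * of_int x / of_int N) = 1" by (simp add: \<omega>_def complex_eq_iff)
  then obtain n :: int where "2 * pi * of_int x / of_int N = of_int n * 2 * pi"
    using cos_one_2pi_int by blast
  hence "(of_int x :: real) = of_int (n * N)" using N by (simp add: field_simps)
  thus "N dvd x" by (simp only: of_int_eq_iff) simp
next
  assume N: "N > 0" and "N dvd x"
  then obtain n where x: "x = N * n" by blast
  have "2 * pi * of_int x / of_int N = 2 * pi * of_int n" using N by (simp add: x)
  thus "\<omega> N x = 1" by (simp add: \<omega>_def complex_eq_iff)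
qed

lemma \<omega>_cong: "N > 0 \<Longrightarrow> [x = y] (mod N) \<Longrightarrow> \<omega> N x = \<omega> N y"
proof -
  assume N: "N > 0" "[x = y] (mod N)"
  hence "\<omega> N (x - y) = 1" by (simp add: \<omega>_eq_1_iff cong_iff_dvd_diff)
  thus ?thesis using \<omega>_add[of N "x - y" y] by simp
qed

lemma sum_shift_mod:
  fixes N c :: int
  assumes "N > 0"
  shows "(\<Sum>x\<in>{0..<N}. f ((x + c) mod N)) = (\<Sum>x\<in>{0..<N}. f x)"
proof (rule sum.reindex_bij_witness[where i = "\<lambda>x. (x - c) mod N" and j = "\<lambda>x. (x + c) mod N"])
  show "((x + c) mod N - c) mod N = x" if "x \<in> {0..<N}" for x
    using that by (simp add: mod_simps)
  show "((x - c) mod N + c) mod N = x" if "x \<in> {0..<N}" for x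
    using that by (simp add: mod_simps)
qed (use assms in auto)

lemma sum_\<omega>:
  assumes N: "N > 0"
  shows "(\<Sum>x\<in>{0..<N}. \<omega> N (a * x)) = (if N dvd a then of_int N else 0)"
proof (cases "N dvd a")
  case True
  hence "\<omega> N (a * x) = 1" for x using N by (simp add: \<omega>_eq_1_iff)
  thus ?thesis using True N by simp
next
  case False
  let ?S = "\<Sum>x\<in>{0..<N}. \<omega> N (a * x)"
  have "?S = (\<Sum>x\<in>{0..<N}. \<omega> N (a * ((x + 1) mod N)))"
    by (rule sum_shift_mod[OF N, symmetric])
  also have "\<dots> = (\<Sum>x\<in>{0..<N}. \<omega> N a * \<omega> N (a * x))"
  proof (rule sum.cong[OF refl])
    fix x
    have "\<omega> N (a * ((x + 1) mod N)) = \<omega> N (a + a * x)"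
      by (rule \<omega>_cong[OF N]) (simp add: cong_def mod_simps algebra_simps)
    thus "\<omega> N (a * ((x + 1) mod N)) = \<omega> N a * \<omega> N (a * x)" by (simp add: \<omega>_add)
  qed
  also have "\<dots> = \<omega> N a * ?S" by (simp add: sum_distrib_left)
  finally have "(1 - \<omega> N a) * ?S = 0" by (simp add: algebra_simps)
  thus ?thesis using False N by (simp add: \<omega>_eq_1_iff)
qed

text \<open>Unnormalised discrete Fourier coefficients, whence the factor \<open>N\<close> in
  \<open>fourier_inversion\<close>.\<close>

definition fc :: "int \<Rightarrow> (int \<Rightarrow> complex) \<Rightarrow> int \<Rightarrow> complex" where
  "fc N f a = (\<Sum>x\<in>{0..<N}. f x * \<omega> N (- (a * x)))"

lemma fc_shift:
  assumes N: "N > 0"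
  shows "fc N (\<lambda>x. f ((x + c) mod N)) a = \<omega> N (a * c) * fc N f a"
proof -
  have "fc N (\<lambda>x. f ((x + c) mod N)) a
      = (\<Sum>x\<in>{0..<N}. (\<lambda>y. f y * (\<omega> N (a * c) * \<omega> N (- (a * y)))) ((x + c) mod N))"
    unfolding fc_def
  proof (rule sum.cong[OF refl])
    fix x
    have "[a * ((x + c) mod N) = a * (x + c)] (mod N)"
      by (simp add: cong_def mod_simps)
    hence "[a * c + - (a * ((x + c) mod N)) = a * c + - (a * (x + c))] (mod N)"
      by (intro cong_add cong_refl) (simp only: cong_minus_minus_iff)
    moreover have "a * c + - (a * (x + c)) = - (a * x)" by (simp add: algebra_simps)
    ultimately have "\<omega> N (- (a * x)) = \<omega> N (a * c + - (a * ((x + c) mod N)))"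
      using \<omega>_cong[OF N] by metis
    thus "f ((x + c) mod N) * \<omega> N (- (a * x))
        = (\<lambda>y. f y * (\<omega> N (a * c) * \<omega> N (- (a * y)))) ((x + c) mod N)"
      by (simp only: \<omega>_add)
  qed
  also have "\<dots> = (\<Sum>x\<in>{0..<N}. f x * (\<omega> N (a * c) * \<omega> N (- (a * x))))"
    by (rule sum_shift_mod[OF N])
  also have "\<dots> = \<omega> N (a * c) * fc N f a"
    by (simp add: fc_def sum_distrib_left mult_ac)
  finally show ?thesis .
qed

lemma fc_add: "fc N (\<lambda>x. f x + g x) a = fc N f a + fc N g a"
  by (simp add: fc_def algebra_simps sum.distrib)

lemma fc_scale: "fc N (\<lambda>x. c * f x) a = c * fc N f a"
  by (simp add: fc_def sum_distrib_left mult_ac)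

lemma fc_0: "fc N f 0 = (\<Sum>x\<in>{0..<N}. f x)"
  by (simp add: fc_def)

lemma fc_cong: "(\<And>x. x \<in> {0..<N} \<Longrightarrow> f x = g x) \<Longrightarrow> fc N f a = fc N g a"
  by (simp add: fc_def)

lemma fourier_inversion:
  assumes N: "N > 0" and y: "y \<in> {0..<N}"
  shows "(\<Sum>a\<in>{0..<N}. fc N f a * \<omega> N (a * y)) = of_int N * f y"
proof -
  have "(\<Sum>a\<in>{0..<N}. fc N f a * \<omega> N (a * y))
      = (\<Sum>a\<in>{0..<N}. \<Sum>x\<in>{0..<N}. f x * \<omega> N ((y - x) * a))"
  proof (rule sum.cong[OF refl])
    fix a
    have "\<omega> N (- (a * x)) * \<omega> N (a * y) = \<omega> N ((y - x) * a)" for x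
      by (simp add: \<omega>_add[symmetric] algebra_simps)
    thus "fc N f a * \<omega> N (a * y) = (\<Sum>x\<in>{0..<N}. f x * \<omega> N ((y - x) * a))"
      by (simp add: fc_def sum_distrib_right mult.assoc)
  qed
  also have "\<dots> = (\<Sum>x\<in>{0..<N}. \<Sum>a\<in>{0..<N}. f x * \<omega> N ((y - x) * a))"
    by (rule sum.swap)
  also have "\<dots> = (\<Sum>x\<in>{0..<N}. if x = y then of_int N * f x else 0)"
  proof (rule sum.cong[OF refl])
    fix x assume x: "x \<in> {0..<N}"
    have "N dvd y - x \<longleftrightarrow> x = y"
    proof
      assume "N dvd y - x"
      hence "y mod N = x mod N" by (simp add: mod_eq_dvd_iff)
      thus "x = y" using x y by simp
    qed simp
    thus "(\<Sum>a\<in>{0..<N}. f x * \<omega> N ((y - x) * a)) = (if x = y then of_int N * f x else 0)"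
      using sum_\<omega>[OF N, of "y - x"] by (simp add: sum_distrib_left[symmetric])
  qed
  also have "\<dots> = of_int N * f y" using y by simp
  finally show ?thesis .
qed

lemma constant_if_fc_zero:
  assumes N: "N > 0" and z: "\<And>a. 0 < a \<Longrightarrow> a < N \<Longrightarrow> fc N f a = 0" and y: "y \<in> {0..<N}"
  shows "of_int N * f y = fc N f 0"
proof -
  have "of_int N * f y = (\<Sum>a\<in>{0..<N}. fc N f a * \<omega> N (a * y))"
    by (rule fourier_inversion[OF N y, symmetric])
  also have "\<dots> = (\<Sum>a\<in>{0}. fc N f a * \<omega> N (a * y))"
    by (rule sum.mono_neutral_right) (use N z in auto)
  finally show ?thesis by simp
qed

lemma norm_1_plus_\<omega>: "(cmod (1 + \<omega> N x))\<^sup>2 = 2 + 2 * cos (2 * pi * of_int x / of_int N)"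
proof -
  have "(cmod (1 + \<omega> N x))\<^sup>2 = (1 + cos (2 * pi * of_int x / of_int N))\<^sup>2 + (sin (2 * pi * of_int x / of_int N))\<^sup>2"
    by (simp add: \<omega>_def cmod_def)
  also have "\<dots> = 1 + 2 * cos (2 * pi * of_int x / of_int N)
      + ((cos (2 * pi * of_int x / of_int N))\<^sup>2 + (sin (2 * pi * of_int x / of_int N))\<^sup>2)"
    by (simp add: power2_eq_square algebra_simps)
  finally show ?thesis by simp
qed

lemma norm_1_plus_\<omega>_uminus: "cmod (1 + \<omega> N (- x)) = cmod (1 + \<omega> N x)"
  by (metis cnj_\<omega> complex_cnj_add complex_cnj_one complex_mod_cnj)

lemma norm_1_plus_\<omega>_le_2: "cmod (1 + \<omega> N x) \<le> 2"
  using norm_triangle_ineq[of 1 "\<omega> N x"] by simp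

lemma kop_adj:
  assumes "finite V" "E \<subseteq> V \<times> V"
  shows "kop V (adj E) f u = (\<Sum>w\<in>E `` {u}. f w)"
proof -
  have "kop V (adj E) f u = (\<Sum>w\<in>V. if w \<in> E `` {u} then f w else 0)"
    unfolding kop_def adj_def by (rule sum.cong) auto
  also have "\<dots> = (\<Sum>w\<in>V \<inter> E `` {u}. f w)"
    using assms by (simp add: sum.inter_restrict)
  also have "V \<inter> E `` {u} = E `` {u}" using assms by auto
  finally show ?thesis .
qed

lemma orthonormal_eigenfunctions_from_family:
  assumes fin: "finite V"
    and ev: "\<And>y. y < n \<Longrightarrow> eigenfunction V a \<mu> (F y)"
    and orth: "\<And>y z. y < n \<Longrightarrow> z < n \<Longrightarrow> y \<noteq> z \<Longrightarrow> ip V (F y) (F z) = 0"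
    and nz: "\<And>y. y < n \<Longrightarrow> \<exists>v\<in>V. F y v \<noteq> 0"
  shows "\<exists>us. length us = n \<and> orthonormal V us \<and> (\<forall>u\<in>set us. eigenfunction V a \<mu> u)"
proof -
  define r where "r y = complex_of_real (1 / sqrt (Re (ip V (F y) (F y))))" for y
  define us where "us = map (\<lambda>y v. r y * F y v) [0..<n]"
  have ipr: "ip V (\<lambda>v. r y * F y v) (\<lambda>v. r z * F z v) = r y * (cnj (r z) * ip V (F y) (F z))" for y z
    by (simp add: ip_scale_left ip_scale_right)
  have norm: "r y * (cnj (r y) * ip V (F y) (F y)) = 1" if "y < n" for y
  proof -
    define q where "q = Re (ip V (F y) (F y))"
    have q: "ip V (F y) (F y) = of_real q" by (simp add: q_def ip_self)
    have "ip V (F y) (F y) \<noteq> 0" using nz[OF that] ip_self_eq_0_iff[OF fin] by blast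
    hence "q > 0" using ip_self_nonneg[of V "F y"] by (auto simp: q_def[symmetric] q)
    hence "1 / sqrt q * (1 / sqrt q * q) = 1" by (simp add: real_div_sqrt)
    hence "complex_of_real (1 / sqrt q * (1 / sqrt q * q)) = 1" by simp
    thus ?thesis
      by (simp only: r_def q Re_complex_of_real complex_cnj_complex_of_real of_real_mult)
  qed
  have "orthonormal V us"
    by (auto simp: orthonormal_def us_def ipr norm orth)
  moreover have "eigenfunction V a \<mu> u" if "u \<in> set us" for u
    using that ev by (auto simp: us_def eigenfunction_def kop_scale)
  moreover have "length us = n" by (simp add: us_def)
  ultimately show ?thesis by blast
qed

section \<open>The layered affine graph\<close>

text \<open>The arithmetic is isolated here. \<open>\<gamma>\<close> is a discrete exponential, made
  periodic on all integers; \<open>\<gamma>_half\<close> makes the matching an involution;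
  \<open>v_0\<close> serves connectedness; \<open>L_le\<close> is the condition of
  \<open>cos_pi_gap\<close>; \<open>v_mix\<close> provides the weak edge of
  \<open>weighted_path_no_large_eigenvalue\<close>, with its margins 3 and 6.\<close>

locale layered_affine_graph =
  fixes p :: int and \<gamma> :: "int \<Rightarrow> int" and L :: nat and v :: "nat \<Rightarrow> int"
  assumes prime_p: "prime p" and p_gt_2: "p > 2"
    and \<gamma>_bij: "bij_betw \<gamma> {0..<p - 1} {1..<p}"
    and \<gamma>_mod: "\<And>x. \<gamma> (x mod (p - 1)) = \<gamma> x"
    and \<gamma>_add: "\<And>x y. [\<gamma> (x + y) = \<gamma> x * \<gamma> y] (mod p)"
    and \<gamma>_half: "\<And>x. [\<gamma> (x + (p - 1) div 2) = - \<gamma> x] (mod p)"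
    and \<gamma>_0: "\<gamma> 0 = 1"
    and L_ge: "L \<ge> 12" and L_le: "real (L + 1) ^ 3 \<le> of_int (p - 1)"
    and v_range: "\<And>s. 0 < v s \<and> v s < p - 1" and v_0: "v 0 = 1"
    and v_mix: "\<And>a. 0 < a \<Longrightarrow> a < p - 1 \<Longrightarrow>
      \<exists>b. 3 \<le> b \<and> b + 6 \<le> L \<and> cos (2 * pi * of_int (a * v b) / of_int (p - 1)) \<le> 0"
begin

definition "N = p - 1"
definition "H = (p - 1) div 2"
definition "V = {0..<p} \<times> {0..<N} \<times> {0..<L}"

fun nbrs :: "int \<times> int \<times> nat \<Rightarrow> (int \<times> int \<times> nat) set" where
  "nbrs (i, x, s) =
    (if s + 1 < L then {(i, x, s + 1), (i, (x + v s) mod N, s + 1)} else {}) \<union>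
    ((if s > 0 then {(i, x, s - 1), (i, (x - v (s - 1)) mod N, s - 1)} else {}) \<union>
     (if s = 0 then {((i + \<gamma> x) mod p, (x + H) mod N, 0)} else {}))"

definition "E = {(u, w). u \<in> V \<and> w \<in> nbrs u}"

section \<open>Symmetry, degrees and connectedness\<close>

lemma N_pos: "N > 0" and p_pos: "p > 0" and N_ge: "N \<ge> 2"
  using p_gt_2 by (auto simp: N_def)

lemma N_eq: "N = 2 * H"
proof -
  have "odd p" using prime_p p_gt_2 by (intro prime_odd_int) auto
  thus ?thesis by (simp add: N_def H_def)
qed

lemma \<gamma>_range: "0 < \<gamma> x" "\<gamma> x < p"
proof -
  have "x mod N \<in> {0..<p - 1}" using N_pos by (simp add: N_def)
  hence "\<gamma> (x mod N) \<in> {1..<p}" using bij_betwE[OF \<gamma>_bij] by blast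
  thus "0 < \<gamma> x" "\<gamma> x < p" using \<gamma>_mod by (auto simp: N_def)
qed

lemma \<gamma>_inj: "x \<in> {0..<N} \<Longrightarrow> y \<in> {0..<N} \<Longrightarrow> \<gamma> x = \<gamma> y \<Longrightarrow> x = y"
  using \<gamma>_bij by (auto simp: bij_betw_def N_def dest: inj_onD)

lemma finite_V [simp]: "finite V"
  by (simp add: V_def)

lemma card_V: "card V = nat p * nat N * L"
  by (simp add: V_def card_cartesian_product)

lemma sum_V: "(\<Sum>w\<in>V. f w) = (\<Sum>i\<in>{0..<p}. \<Sum>x\<in>{0..<N}. \<Sum>s<L. f (i, x, s))"
  by (simp add: V_def sum.cartesian_product case_prod_unfold atLeast0LessThan)

lemma nbrs_subset: "u \<in> V \<Longrightarrow> nbrs u \<subseteq> V"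
  using N_pos p_pos by (cases u) (auto simp: V_def)

lemma E_subset: "E \<subseteq> V \<times> V"
  using nbrs_subset by (auto simp: E_def)

lemma E_image: "u \<in> V \<Longrightarrow> E `` {u} = nbrs u"
  by (auto simp: E_def)

text \<open>Keeps the two neighbours in an adjacent layer distinct, so that summing over the set
  \<open>nbrs\<close> counts both of them.\<close>

lemma v_shift_neq:
  assumes x: "x \<in> {0..<N}"
  shows "(x + v s) mod N \<noteq> x" "(x - v s) mod N \<noteq> x"
proof -
  have vs: "0 < v s" "v s < N" using v_range by (auto simp: N_def)
  have "(x + v s) mod N = x mod N \<longleftrightarrow> N dvd v s"
    by (simp add: mod_eq_dvd_iff)
  moreover have "(x - v s) mod N = x mod N \<longleftrightarrow> N dvd v s"
    by (simp add: mod_eq_dvd_iff)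
  moreover have "\<not> N dvd v s" using vs zdvd_not_zless by blast
  ultimately show "(x + v s) mod N \<noteq> x" "(x - v s) mod N \<noteq> x"
    using x by auto
qed

lemma sym_E: "sym E"
proof (rule symI)
  fix u w assume uw: "(u, w) \<in> E"
  obtain i x s where u: "u = (i, x, s)" by (cases u)
  have V: "i \<in> {0..<p}" "x \<in> {0..<N}" "s < L" using uw by (auto simp: E_def V_def u)
  have wV: "w \<in> V" using uw E_subset by auto
  from uw have "w \<in> nbrs (i, x, s)" by (simp add: E_def u)
  then consider
    "s + 1 < L" "w = (i, x, s + 1)" | "s + 1 < L" "w = (i, (x + v s) mod N, s + 1)"
    | "s > 0" "w = (i, x, s - 1)" | "s > 0" "w = (i, (x - v (s - 1)) mod N, s - 1)"
    | "s = 0" "w = ((i + \<gamma> x) mod p, (x + H) mod N, 0)"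
    by (auto split: if_splits)
  hence "u \<in> nbrs w"
  proof cases
    case 5
    \<comment> \<open>Following the matching twice returns to the start: \<open>2 * H\<close> is
      \<open>N\<close>, and \<open>\<gamma>\<close> changes sign under the shift by
      \<open>H\<close>, so the two translations cancel.\<close>
    have "((x + H) mod N + H) mod N = (x + 2 * H) mod N"
      by (simp add: mod_simps algebra_simps)
    hence x: "((x + H) mod N + H) mod N = x" using V by (simp add: N_eq[symmetric])
    have "[\<gamma> ((x + H) mod N) = - \<gamma> x] (mod p)"
      using \<gamma>_half[of x] \<gamma>_mod[of "x + H"] by (simp add: N_def H_def)
    hence "[(i + \<gamma> x) mod p + \<gamma> ((x + H) mod N) = i] (mod p)"
      using cong_add[of "(i + \<gamma> x) mod p" "i + \<gamma> x" p "\<gamma> ((x + H) mod N)" "- \<gamma> x"]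
      by (simp add: cong_def)
    hence "((i + \<gamma> x) mod p + \<gamma> ((x + H) mod N)) mod p = i"
      using V by (simp add: cong_def)
    thus ?thesis using 5 x by (simp add: u)
  qed (use V in \<open>auto simp: u mod_simps\<close>)
  thus "(w, u) \<in> E" using wV by (simp add: E_def)
qed

lemma irrefl_E: "irrefl E"
proof -
  have "x \<noteq> (x + H) mod N" if "x \<in> {0..<N}" for x
  proof -
    have "(x + H) mod N = x mod N \<longleftrightarrow> N dvd H" by (simp add: mod_eq_dvd_iff)
    moreover have "0 < H" "H < N" using N_eq N_pos by auto
    hence "\<not> N dvd H" using zdvd_not_zless by blast
    ultimately show ?thesis using that by auto
  qed
  thus ?thesis by (auto simp: irrefl_def E_def V_def split: if_splits)
qed

lemma kop_E:
  assumes "i \<in> {0..<p}" "x \<in> {0..<N}" "s < L"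
  shows "kop V (adj E) f (i, x, s) =
    (if s + 1 < L then f (i, x, s + 1) + f (i, (x + v s) mod N, s + 1) else 0) +
    (if s > 0 then f (i, x, s - 1) + f (i, (x - v (s - 1)) mod N, s - 1) else 0) +
    (if s = 0 then f ((i + \<gamma> x) mod p, (x + H) mod N, 0) else 0)"
proof -
  have V: "(i, x, s) \<in> V" using assms by (auto simp: V_def)
  have "kop V (adj E) f (i, x, s) = (\<Sum>w\<in>nbrs (i, x, s). f w)"
    using kop_adj[OF finite_V E_subset] E_image[OF V] by simp
  also have "\<dots> = (\<Sum>w\<in>(if s + 1 < L then {(i, x, s + 1), (i, (x + v s) mod N, s + 1)} else {}). f w) +
     ((\<Sum>w\<in>(if s > 0 then {(i, x, s - 1), (i, (x - v (s - 1)) mod N, s - 1)} else {}). f w) +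
      (\<Sum>w\<in>(if s = 0 then {((i + \<gamma> x) mod p, (x + H) mod N, 0)} else {}). f w))"
    unfolding nbrs.simps
    by (subst sum.union_disjoint, simp, simp, force, subst sum.union_disjoint) auto
  also have "\<dots> = (if s + 1 < L then f (i, x, s + 1) + f (i, (x + v s) mod N, s + 1) else 0) +
    (if s > 0 then f (i, x, s - 1) + f (i, (x - v (s - 1)) mod N, s - 1) else 0) +
    (if s = 0 then f ((i + \<gamma> x) mod p, (x + H) mod N, 0) else 0)"
    using v_shift_neq[OF assms(2)] by (auto simp: eq_commute[of x])
  finally show ?thesis .
qed

lemma card_nbrs_le: "u \<in> V \<Longrightarrow> card (nbrs u) \<le> 4"
proof -
  obtain i x s where u: "u = (i, x, s)" by (cases u)
  let ?A = "if s + 1 < L then {(i, x, s + 1), (i, (x + v s) mod N, s + 1)} else {}"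
  let ?B = "if s > 0 then {(i, x, s - 1), (i, (x - v (s - 1)) mod N, s - 1)} else {}"
  let ?C = "if s = 0 then {((i + \<gamma> x) mod p, (x + H) mod N, 0 :: nat)} else {}"
  have 2: "card {a, b} \<le> 2" for a b :: "int \<times> int \<times> nat" by (simp add: card_insert_if)
  have "card ?A \<le> 2" "card (?B \<union> ?C) \<le> 2" using 2 by auto
  thus "card (nbrs u) \<le> 4"
    unfolding u nbrs.simps using card_Un_le[of ?A "?B \<union> ?C"] by linarith
qed

lemma card_nbrs_eq: "card (nbrs (0, 0, 1)) = 4"
proof -
  have 0: "0 \<in> {0..<N}" using N_pos by simp
  show ?thesis
    using L_ge v_shift_neq[OF 0] by (auto simp: card_insert_if eq_commute[of 0])
qed

text \<open>Two edges through layer 1 realise x -> x + 1 in the bottom layer because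
  \<open>v 0 = 1\<close>, and the matching edge at x = 0 leads from copy i to copy i + 1 because
  \<open>\<gamma> 0 = 1\<close>.\<close>

lemma reach_origin:
  assumes "u \<in> V"
  shows "(u, (0, 0, 0)) \<in> E\<^sup>*"
proof -
  have edge: "(u, w) \<in> E\<^sup>*" if "u \<in> V" "w \<in> nbrs u" for u w
    using that by (auto simp: E_def)
  obtain i x s where u: "u = (i, x, s)" "i \<in> {0..<p}" "x \<in> {0..<N}" "s < L"
    using assms by (auto simp: V_def)
  have down: "((i, x, s), (i, x, 0)) \<in> E\<^sup>*" if "i \<in> {0..<p}" "x \<in> {0..<N}" "s < L" for i x s
    using that
  proof (induction s)
    case (Suc s)
    have "((i, x, Suc s), (i, x, s)) \<in> E\<^sup>*"
      using Suc.prems by (intro edge) (auto simp: V_def)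
    thus ?case using Suc by (auto intro: rtrancl_trans)
  qed simp
  have along: "((i, int n, 0), (i, 0, 0)) \<in> E\<^sup>*" if "i \<in> {0..<p}" "int n < N" for i n
    using that
  proof (induction n)
    case (Suc n)
    have "((i, int n, 0), (i, int (Suc n), 1)) \<in> E\<^sup>*"
      using Suc.prems L_ge v_0 by (intro edge) (auto simp: V_def)
    moreover have "((i, int (Suc n), 1), (i, int (Suc n), 0)) \<in> E\<^sup>*"
      using Suc.prems L_ge by (intro down) auto
    ultimately have "((i, int n, 0), (i, int (Suc n), 0)) \<in> E\<^sup>*" by (rule rtrancl_trans)
    hence "((i, int (Suc n), 0), (i, int n, 0)) \<in> E\<^sup>*"
      using sym_E by (metis sym_rtrancl symE)
    moreover have "((i, int n, 0), (i, 0, 0)) \<in> E\<^sup>*" using Suc by auto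
    ultimately show ?case by (rule rtrancl_trans)
  qed simp
  have base: "((int n, 0, 0), (0, 0, 0)) \<in> E\<^sup>*" if "int n < p" for n
    using that
  proof (induction n)
    case (Suc n)
    have "((int n, 0, 0), (int (Suc n), H mod N, 0)) \<in> E\<^sup>*"
      using Suc.prems L_ge N_pos \<gamma>_0 by (intro edge) (auto simp: V_def)
    moreover have "((int (Suc n), int (nat (H mod N)), 0), (int (Suc n), 0, 0)) \<in> E\<^sup>*"
      using Suc.prems N_pos by (intro along) auto
    ultimately have "((int n, 0, 0), (int (Suc n), 0, 0)) \<in> E\<^sup>*"
      using N_pos by (auto intro: rtrancl_trans)
    hence "((int (Suc n), 0, 0), (int n, 0, 0)) \<in> E\<^sup>*"
      using sym_E by (metis sym_rtrancl symE)
    moreover have "((int n, 0, 0), (0, 0, 0)) \<in> E\<^sup>*" using Suc by auto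
    ultimately show ?case by (rule rtrancl_trans)
  qed simp
  have "(u, (i, x, 0)) \<in> E\<^sup>*" using down u by simp
  moreover have "((i, x, 0), (i, 0, 0)) \<in> E\<^sup>*" using along[of i "nat x"] u by simp
  moreover have "((i, 0, 0), (0, 0, 0)) \<in> E\<^sup>*" using base[of "nat i"] u by simp
  ultimately show ?thesis by (meson rtrancl_trans)
qed

section \<open>Sums over the copies, that is, the part independent of the first coordinate\<close>

definition fibre_sum :: "(int \<times> int \<times> nat \<Rightarrow> complex) \<Rightarrow> int \<Rightarrow> nat \<Rightarrow> complex" where
  "fibre_sum f x s = (\<Sum>i\<in>{0..<p}. f (i, x, s))"

text \<open>Summation over all copies absorbs the translation by \<open>\<gamma> x\<close>, so all
  that remains of the matching is the shift by \<open>H\<close>.\<close>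

lemma fibre_sum_kop:
  assumes "x \<in> {0..<N}" "s < L"
  shows "fibre_sum (kop V (adj E) f) x s =
    (if s + 1 < L then fibre_sum f x (s + 1) + fibre_sum f ((x + v s) mod N) (s + 1) else 0) +
    (if s > 0 then fibre_sum f x (s - 1) + fibre_sum f ((x - v (s - 1)) mod N) (s - 1) else 0) +
    (if s = 0 then fibre_sum f ((x + H) mod N) 0 else 0)"
proof -
  have "fibre_sum (kop V (adj E) f) x s = (\<Sum>i\<in>{0..<p}.
    (if s + 1 < L then f (i, x, s + 1) + f (i, (x + v s) mod N, s + 1) else 0) +
    (if s > 0 then f (i, x, s - 1) + f (i, (x - v (s - 1)) mod N, s - 1) else 0) +
    (if s = 0 then f ((i + \<gamma> x) mod p, (x + H) mod N, 0) else 0))"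
    unfolding fibre_sum_def by (rule sum.cong[OF refl kop_E]) (use assms in auto)
  also have "\<dots> = (if s + 1 < L then fibre_sum f x (s + 1) + fibre_sum f ((x + v s) mod N) (s + 1) else 0) +
    (if s > 0 then fibre_sum f x (s - 1) + fibre_sum f ((x - v (s - 1)) mod N) (s - 1) else 0) +
    (if s = 0 then (\<Sum>i\<in>{0..<p}. f ((i + \<gamma> x) mod p, (x + H) mod N, 0)) else 0)"
    by (simp add: fibre_sum_def sum.distrib)
  also have "(\<Sum>i\<in>{0..<p}. f ((i + \<gamma> x) mod p, (x + H) mod N, 0)) = fibre_sum f ((x + H) mod N) 0"
    unfolding fibre_sum_def
    using sum_shift_mod[OF p_pos, of "\<lambda>i. f (i, (x + H) mod N, 0)"] by simp
  finally show ?thesis .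
qed

text \<open>Each nonzero frequency in the second coordinate obeys a path equation in which
  \<open>v_mix\<close> supplies a weak edge, so it vanishes above 4 cos(pi/L); only the constant
  part survives.\<close>

lemma fibre_sum_constant:
  assumes ev: "eigenfunction V (adj E) d u" and d: "d > 4 * cos (pi / L)"
    and x: "x \<in> {0..<N}" and s: "s < L"
  shows "of_int N * fibre_sum u x s = fc N (\<lambda>x. fibre_sum u x s) 0"
proof (rule constant_if_fc_zero[OF N_pos _ x])
  fix a assume a: "0 < a" "a < N"
  define w where "w s = fc N (\<lambda>x. fibre_sum u x s) a" for s
  define c where "c s = cmod (1 + \<omega> N (a * v s))" for s
  have eq: "of_real d * w s = (if s + 1 < L then (1 + \<omega> N (a * v s)) * w (s + 1) else 0) +
      (if s > 0 then (1 + \<omega> N (- (a * v (s - 1)))) * w (s - 1) else 0) +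
      (if s = 0 then \<omega> N (a * H) * w 0 else 0)" if s: "s < L" for s
  proof -
    have "of_real d * w s = fc N (\<lambda>x. of_real d * fibre_sum u x s) a"
      by (simp add: w_def fc_scale)
    also have "\<dots> = fc N (\<lambda>x.
      (if s + 1 < L then fibre_sum u x (s + 1) + fibre_sum u ((x + v s) mod N) (s + 1) else 0) +
      (if s > 0 then fibre_sum u x (s - 1) + fibre_sum u ((x + - v (s - 1)) mod N) (s - 1) else 0) +
      (if s = 0 then fibre_sum u ((x + H) mod N) 0 else 0)) a"
    proof (rule fc_cong)
      fix x assume x: "x \<in> {0..<N}"
      have "of_real d * fibre_sum u x s = fibre_sum (kop V (adj E) u) x s"
        unfolding fibre_sum_def sum_distrib_left
        by (rule sum.cong[OF refl]) (use ev x s in \<open>auto simp: eigenfunction_def V_def\<close>)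
      thus "of_real d * fibre_sum u x s =
        (if s + 1 < L then fibre_sum u x (s + 1) + fibre_sum u ((x + v s) mod N) (s + 1) else 0) +
        (if s > 0 then fibre_sum u x (s - 1) + fibre_sum u ((x + - v (s - 1)) mod N) (s - 1) else 0) +
        (if s = 0 then fibre_sum u ((x + H) mod N) 0 else 0)"
        using fibre_sum_kop[OF x s, of u] by simp
    qed
    also have "\<dots> = (if s + 1 < L then (1 + \<omega> N (a * v s)) * w (s + 1) else 0) +
      (if s > 0 then (1 + \<omega> N (- (a * v (s - 1)))) * w (s - 1) else 0) +
      (if s = 0 then \<omega> N (a * H) * w 0 else 0)"
    proof -
      have fc_zero: "fc N (\<lambda>x. 0) a = 0" by (simp add: fc_def)
      have sh: "fc N (\<lambda>x. fibre_sum u ((x + k) mod N) t) a = \<omega> N (a * k) * w t" for k t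
        unfolding w_def by (rule fc_shift[OF N_pos, of "\<lambda>x. fibre_sum u x t"])
      show ?thesis
        unfolding fc_add if_distrib[of "\<lambda>f. fc N f a"]
        using sh[of "v s"] sh[of "- v (s - 1)"] sh[of H]
        by (auto simp: fc_add fc_zero w_def[symmetric] algebra_simps)
    qed
    finally show ?thesis .
  qed
  obtain b where b: "3 \<le> b" "b + 6 \<le> L" "cos (2 * pi * of_int (a * v b) / of_int N) \<le> 0"
    using v_mix[of a] a by (auto simp: N_def)
  have "w s = 0"
  proof (rule weighted_path_no_large_eigenvalue[OF L_ge _ _ b(1,2) _ _ d s])
    show "c t \<ge> 0" "c t \<le> 2" for t by (simp_all add: c_def norm_1_plus_\<omega>_le_2)
    have "(c b)\<^sup>2 \<le> 2" using b(3) by (simp add: c_def norm_1_plus_\<omega>)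
    thus "c b \<le> sqrt 2" by (rule real_le_rsqrt)
  next
    fix t assume t: "t < L"
    \<comment> \<open>Only moduli are kept: the phases of the edges and of the loop disappear in the
      triangle inequality.\<close>
    have "d * cmod (w t) \<le> cmod (of_real d * w t)"
      by (simp add: norm_mult mult_right_mono)
    also have "\<dots> \<le> (if t + 1 < L then c t * cmod (w (t + 1)) else 0)
      + (if t > 0 then c (t - 1) * cmod (w (t - 1)) else 0)
      + (if t = 0 then cmod (w 0) else 0)"
      unfolding eq[OF t]
      by (intro order_trans[OF norm_triangle_ineq] add_mono)
        (auto simp: norm_mult c_def norm_1_plus_\<omega>_uminus)
    finally show "d * cmod (w t) \<le> (if t + 1 < L then c t * cmod (w (t + 1)) else 0)
      + (if t > 0 then c (t - 1) * cmod (w (t - 1)) else 0)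
      + (if t = 0 then cmod (w 0) else 0)" .
  qed
  thus "fc N (\<lambda>x. fibre_sum u x s) a = 0" by (simp add: w_def)
qed

section \<open>Functions with vanishing fibre sums\<close>

definition fibre_indicators :: "(int \<times> int \<times> nat \<Rightarrow> complex) set" where
  "fibre_indicators = (\<lambda>(x, s) w. if snd w = (x, s) then 1 else 0) ` ({0..<N} \<times> {..<L})"

text \<open>Vanishing fibre sums are encoded as orthogonality to indicators, the form in which
  \<open>top_eigenfunction\<close> takes a subspace.\<close>

abbreviation "fibre_zero \<equiv> supported_orth V fibre_indicators"

lemma ip_fibre_indicator:
  assumes "x0 \<in> {0..<N}" "s0 < L"
  shows "ip V f (\<lambda>w. if snd w = (x0, s0) then 1 else 0) = fibre_sum f x0 s0"
proof -
  have "ip V f (\<lambda>w. if snd w = (x0, s0) then 1 else 0)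
      = (\<Sum>i\<in>{0..<p}. \<Sum>x\<in>{0..<N}. \<Sum>s<L. if x = x0 then if s = s0 then f (i, x, s) else 0 else 0)"
    unfolding ip_def sum_V by (intro sum.cong refl) auto
  also have "\<dots> = (\<Sum>i\<in>{0..<p}. \<Sum>x\<in>{0..<N}. if x = x0 then f (i, x, s0) else 0)"
    using assms by (intro sum.cong refl) auto
  also have "\<dots> = fibre_sum f x0 s0"
    using assms by (simp add: fibre_sum_def)
  finally show ?thesis .
qed

lemma fibre_zero_iff:
  "f \<in> fibre_zero \<longleftrightarrow>
    (\<forall>w. w \<notin> V \<longrightarrow> f w = 0) \<and> (\<forall>x\<in>{0..<N}. \<forall>s<L. fibre_sum f x s = 0)"
  by (auto simp: supported_orth_def fibre_indicators_def ip_fibre_indicator)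

lemma fibre_zero_invariant:
  assumes "f \<in> fibre_zero" "g \<in> fibre_indicators"
  shows "ip V (kop V (adj E) f) g = 0"
proof -
  obtain x s where xs: "x \<in> {0..<N}" "s < L" "g = (\<lambda>w. if snd w = (x, s) then 1 else 0)"
    using assms(2) by (auto simp: fibre_indicators_def)
  have z: "fibre_sum f x s = 0" if "x \<in> {0..<N}" "s < L" for x s
    using assms(1) that unfolding fibre_zero_iff by blast
  have m: "y mod N \<in> {0..<N}" for y using N_pos by simp
  have "fibre_sum (kop V (adj E) f) x s = 0"
    unfolding fibre_sum_kop[OF xs(1,2)] using xs by (simp add: z m)
  thus ?thesis using ip_fibre_indicator[OF xs(1,2)] xs(3) by simp
qed

lemma adj_sym: "adj E u w = adj E w u"
  using sym_E by (auto simp: adj_def dest: symD)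

section \<open>A trial function and the lower bound for its Rayleigh quotient\<close>

lemma ip_V: "ip V f g = (\<Sum>i\<in>{0..<p}. \<Sum>x\<in>{0..<N}. \<Sum>s<L. f (i, x, s) * cnj (g (i, x, s)))"
  by (simp add: ip_def sum_V)

text \<open>The simplest profile over the copies with sum zero. Any other nonzero real one would
  give the same quotient, since summing over \<open>x\<close> turns the matching into multiplication
  by -1.\<close>

definition dipole :: "int \<Rightarrow> real" where
  "dipole i = (if i = 0 then 1 else if i = 1 then - 1 else 0)"

text \<open>The top eigenfunction of the path on \<open>L\<close> vertices without a loop; layers
  are numbered from 0, hence \<open>s + 1\<close>.\<close>

definition bump :: "nat \<Rightarrow> real" where
  "bump s = sin (real (s + 1) * (pi / (L + 1)))"

definition trial :: "int \<times> int \<times> nat \<Rightarrow> complex" where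
  "trial = (\<lambda>(i, x, s). if (i, x, s) \<in> V then of_real (dipole i * bump s) else 0)"

lemma sum_dipole: "(\<Sum>i\<in>{0..<p}. dipole i) = 0"
proof -
  have "(\<Sum>i\<in>{0..<p}. dipole i) = (\<Sum>i\<in>{0, 1}. dipole i)"
    using p_gt_2 by (intro sum.mono_neutral_right) (auto simp: dipole_def)
  thus ?thesis by (simp add: dipole_def)
qed

lemma sum_dipole_sq: "(\<Sum>i\<in>{0..<p}. dipole i * dipole i) = 2"
proof -
  have "(\<Sum>i\<in>{0..<p}. dipole i * dipole i) = (\<Sum>i\<in>{0, 1}. dipole i * dipole i)"
    using p_gt_2 by (intro sum.mono_neutral_right) (auto simp: dipole_def)
  thus ?thesis by (simp add: dipole_def)
qed

text \<open>The values of \<open>\<gamma>\<close> miss exactly the residue \<open>0\<close>.\<close>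

lemma sum_dipole_\<gamma>:
  assumes "i \<in> {0..<p}"
  shows "(\<Sum>x\<in>{0..<N}. dipole ((i + \<gamma> x) mod p)) = - dipole i"
proof -
  have "(\<Sum>x\<in>{0..<N}. dipole ((i + \<gamma> x) mod p)) = (\<Sum>j\<in>{1..<p}. dipole ((i + j) mod p))"
    using sum.reindex_bij_betw[OF \<gamma>_bij, of "\<lambda>j. dipole ((i + j) mod p)"] by (simp add: N_def)
  moreover have "{0..<p} = insert 0 {1..<p}" using p_gt_2 by auto
  hence "(\<Sum>j\<in>{0..<p}. dipole ((j + i) mod p)) = dipole i + (\<Sum>j\<in>{1..<p}. dipole ((i + j) mod p))"
  proof -
    have "i mod p = i" using assms by simp
    thus ?thesis unfolding \<open>{0..<p} = insert 0 {1..<p}\<close> by (simp add: add.commute)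
  qed
  moreover have "(\<Sum>j\<in>{0..<p}. dipole ((j + i) mod p)) = 0"
    using sum_shift_mod[OF p_pos, of dipole i] sum_dipole by simp
  ultimately show ?thesis by simp
qed

lemma trial_eq: "i \<in> {0..<p} \<Longrightarrow> x \<in> {0..<N} \<Longrightarrow> s < L \<Longrightarrow> trial (i, x, s) = of_real (dipole i * bump s)"
  by (simp add: trial_def V_def)

lemma bump_end: "bump L = 0"
  by (simp add: bump_def)

lemma bump_step: "bump (s + 1) + (if s > 0 then bump (s - 1) else 0) = 2 * cos (pi / (L + 1)) * bump s"
proof -
  define \<theta> where "\<theta> = pi / real (L + 1)"
  have "bump (s + 1) = sin ((real (s + 1) + 1) * \<theta>)"
    by (simp add: bump_def \<theta>_def algebra_simps)
  moreover have "(if s > 0 then bump (s - 1) else 0) = sin ((real (s + 1) - 1) * \<theta>)"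
    by (auto simp: bump_def \<theta>_def of_nat_diff)
  moreover have "bump s = sin (real (s + 1) * \<theta>)" by (simp add: bump_def \<theta>_def)
  ultimately show ?thesis using sin_step[of "real (s + 1)" \<theta>] by (simp add: \<theta>_def add.commute)
qed

lemma trial_fibre_zero: "trial \<in> fibre_zero"
proof -
  have "fibre_sum trial x s = 0" if "x \<in> {0..<N}" "s < L" for x s
  proof -
    have "fibre_sum trial x s = (\<Sum>i\<in>{0..<p}. of_real (dipole i * bump s))"
      unfolding fibre_sum_def by (rule sum.cong[OF refl]) (use that trial_eq in simp)
    also have "\<dots> = of_real ((\<Sum>i\<in>{0..<p}. dipole i) * bump s)"
      by (simp add: sum_distrib_right)
    finally show ?thesis using sum_dipole by simp
  qed
  thus ?thesis unfolding fibre_zero_iff by (auto simp: trial_def)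
qed

lemma kop_trial:
  assumes "i \<in> {0..<p}" "x \<in> {0..<N}" "s < L"
  shows "kop V (adj E) trial (i, x, s) =
    of_real (4 * cos (pi / (L + 1)) * dipole i * bump s
      + (if s = 0 then dipole ((i + \<gamma> x) mod p) * bump 0 else 0))"
proof -
  have m: "y mod N \<in> {0..<N}" "y mod p \<in> {0..<p}" for y using N_pos p_pos by simp_all
  have up: "(if s + 1 < L then trial (i, x, s + 1) + trial (i, (x + v s) mod N, s + 1) else 0)
      = of_real (dipole i * (2 * bump (s + 1)))"
  proof (cases "s + 1 < L")
    case False
    hence "s + 1 = L" using assms by simp
    thus ?thesis using bump_end by simp
  qed (use assms trial_eq m in simp)
  have down: "(if s > 0 then trial (i, x, s - 1) + trial (i, (x - v (s - 1)) mod N, s - 1) else 0)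
      = of_real (dipole i * (2 * (if s > 0 then bump (s - 1) else 0)))"
    using assms trial_eq m by simp
  have match: "(if s = 0 then trial ((i + \<gamma> x) mod p, (x + H) mod N, 0) else 0)
      = of_real (if s = 0 then dipole ((i + \<gamma> x) mod p) * bump 0 else 0)"
    using assms trial_eq m by simp
  have "4 * cos (pi / (L + 1)) * dipole i * bump s
      = dipole i * (2 * (bump (s + 1) + (if s > 0 then bump (s - 1) else 0)))"
    unfolding bump_step by simp
  thus ?thesis
    unfolding kop_E[OF assms] up down match of_real_add[symmetric] of_real_eq_iff
    by (simp add: distrib_left)
qed

text \<open>The matching costs 2 (bump 0)^2 against a squared norm of 2 N S, and S >= (bump 0)^2, so
  it lowers the quotient by at most 1/N.\<close>

lemma trial_rayleigh:
  defines "S \<equiv> (\<Sum>s<L. bump s * bump s)"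
  shows "Re (ip V trial trial) = 2 * of_int N * S"
    and "Re (ip V (kop V (adj E) trial) trial)
      = 4 * cos (pi / (L + 1)) * (2 * of_int N * S) - 2 * (bump 0 * bump 0)"
    and "S \<ge> bump 0 * bump 0" and "bump 0 > 0"
proof -
  have "ip V trial trial = (\<Sum>i\<in>{0..<p}. \<Sum>x\<in>{0..<N}. \<Sum>s<L. of_real ((dipole i * dipole i) * (bump s * bump s)))"
    unfolding ip_V by (intro sum.cong refl) (simp add: trial_eq)
  also have "\<dots> = of_real (\<Sum>i\<in>{0..<p}. \<Sum>x\<in>{0..<N}. \<Sum>s<L. (dipole i * dipole i) * (bump s * bump s))"
    by simp
  also have "(\<Sum>i\<in>{0..<p}. \<Sum>x\<in>{0..<N}. \<Sum>s<L. (dipole i * dipole i) * (bump s * bump s))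
      = (\<Sum>i\<in>{0..<p}. dipole i * dipole i) * (of_int N * S)"
    unfolding sum_distrib_right using N_pos
    by (intro sum.cong refl) (simp add: sum_distrib_left[symmetric] S_def)
  finally have ii: "ip V trial trial = of_real (2 * of_int N * S)"
    unfolding sum_dipole_sq by (simp only: mult.assoc)
  thus "Re (ip V trial trial) = 2 * of_int N * S" by simp
  have L0: "{..<L} = insert 0 {0<..<L}" using L_ge by auto
  have delta: "(\<Sum>s<L. complex_of_real (if s = 0 then c else 0)) = of_real c" for c
    by (simp add: L0)
  have "ip V (kop V (adj E) trial) trial
      = (\<Sum>i\<in>{0..<p}. \<Sum>x\<in>{0..<N}. \<Sum>s<L. of_real (4 * cos (pi / (L + 1))) * (trial (i, x, s) * cnj (trial (i, x, s)))
         + of_real (if s = 0 then dipole ((i + \<gamma> x) mod p) * dipole i * (bump 0 * bump 0) else 0))"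
    unfolding ip_V
  proof (intro sum.cong refl)
    fix i x s assume "i \<in> {0..<p}" "x \<in> {0..<N}" "s \<in> {..<L}"
    thus "kop V (adj E) trial (i, x, s) * cnj (trial (i, x, s))
      = of_real (4 * cos (pi / (L + 1))) * (trial (i, x, s) * cnj (trial (i, x, s)))
         + of_real (if s = 0 then dipole ((i + \<gamma> x) mod p) * dipole i * (bump 0 * bump 0) else 0)"
      by (simp add: kop_trial trial_eq algebra_simps)
  qed
  also have "\<dots> = of_real (4 * cos (pi / (L + 1))) * ip V trial trial
      + of_real (\<Sum>i\<in>{0..<p}. \<Sum>x\<in>{0..<N}. dipole ((i + \<gamma> x) mod p) * dipole i * (bump 0 * bump 0))"
    by (simp only: ip_V sum.distrib sum_distrib_left delta of_real_sum)
  also have "(\<Sum>i\<in>{0..<p}. \<Sum>x\<in>{0..<N}. dipole ((i + \<gamma> x) mod p) * dipole i * (bump 0 * bump 0))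
      = (\<Sum>i\<in>{0..<p}. - (dipole i * dipole i) * (bump 0 * bump 0))"
    by (intro sum.cong refl) (simp add: sum_distrib_right[symmetric] sum_dipole_\<gamma>)
  also have "\<dots> = - 2 * (bump 0 * bump 0)"
    using sum_dipole_sq by (simp add: sum_distrib_right[symmetric] sum_negf)
  finally show "Re (ip V (kop V (adj E) trial) trial)
      = 4 * cos (pi / (L + 1)) * (2 * of_int N * S) - 2 * (bump 0 * bump 0)"
    unfolding ii by simp
  show "S \<ge> bump 0 * bump 0"
    unfolding S_def L0 by (simp add: sum_nonneg)
  show "bump 0 > 0"
    using L_ge by (auto simp: bump_def intro!: sin_gt_zero simp: field_simps)
qed

lemma top_fibre_zero_eigenfunction:
  "\<exists>\<mu> u. \<mu> > 4 * cos (pi / L) \<and> u \<in> fibre_zero \<and> ip V u u = 1 \<and> eigenfunction V (adj E) \<mu> u \<and>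
    (\<forall>f\<in>fibre_zero. Re (ip V (kop V (adj E) f) f) \<le> \<mu> * Re (ip V f f))"
proof -
  have o: "(0, 0, 0) \<in> V" using p_pos N_pos L_ge by (simp add: V_def)
  have "trial (0, 0, 0) \<noteq> 0"
    using o trial_rayleigh(4) by (simp add: trial_def dipole_def)
  from top_eigenfunction[where a = "adj E", OF finite_V adj_sym fibre_zero_invariant trial_fibre_zero o this]
  obtain \<mu> u where u: "u \<in> fibre_zero" "ip V u u = 1"
    "\<forall>w\<in>V. kop V (adj E) u w = of_real \<mu> * u w"
    and bound: "\<forall>f\<in>fibre_zero. Re (ip V (kop V (adj E) f) f) \<le> \<mu> * Re (ip V f f)" by blast
  define S where "S = (\<Sum>s<L. bump s * bump s)"
  note t = trial_rayleigh[folded S_def]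
  have S: "S > 0" using mult_pos_pos[OF t(4,4)] t(3) by linarith
  have N: "real_of_int N > 0" using N_pos by simp
  have "4 * cos (pi / (L + 1)) * (2 * of_int N * S) - 2 * (bump 0 * bump 0) \<le> \<mu> * (2 * of_int N * S)"
    using bound trial_fibre_zero t(1,2) by metis
  hence "4 * cos (pi / (L + 1)) * (2 * of_int N * S) - 2 * S \<le> \<mu> * (2 * of_int N * S)"
    using t(3) by linarith
  also have "4 * cos (pi / (L + 1)) * (2 * of_int N * S) - 2 * S
      = (4 * cos (pi / (L + 1)) - 1 / of_int N) * (2 * of_int N * S)"
    using N by (simp add: field_simps)
  finally have "4 * cos (pi / (L + 1)) - 1 / of_int N \<le> \<mu>"
    using N S by (simp add: mult_le_cancel_right)
  moreover have "4 * cos (pi / L) < 4 * cos (pi / (L + 1)) - 1 / of_int N"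
    using cos_pi_gap[of L "of_int N"] L_ge L_le by (simp add: N_def)
  ultimately have "\<mu> > 4 * cos (pi / L)" by linarith
  thus ?thesis using u bound by (auto simp: eigenfunction_def)
qed

text \<open>Subtracting from \<open>u\<close> its layer averages leaves an eigenfunction for
  \<open>d\<close> with vanishing fibre sums. As \<open>d\<close> exceeds the variational bound
  \<open>\<mu>\<close> on that space, the difference is zero and \<open>u\<close> depends on the
  layer alone.\<close>

lemma eigenfunction_above_fibre_zero:
  assumes ev: "eigenfunction V (adj E) d u" and d: "d > 4 * cos (pi / L)" "d > \<mu>"
    and bound: "\<And>f. f \<in> fibre_zero \<Longrightarrow> Re (ip V (kop V (adj E) f) f) \<le> \<mu> * Re (ip V f f)"
  shows "\<exists>w. (\<forall>i\<in>{0..<p}. \<forall>x\<in>{0..<N}. \<forall>s<L. u (i, x, s) = w s) \<and>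
    (\<forall>s. 0 < s \<longrightarrow> s < L \<longrightarrow>
      of_real d * w s = (if s + 1 < L then 2 * w (s + 1) else 0) + 2 * w (s - 1))"
proof -
  define w where "w s = fc N (\<lambda>x. fibre_sum u x s) 0 / of_int N / of_int p" for s
  have fs: "fibre_sum u x s = of_int p * w s" if "x \<in> {0..<N}" "s < L" for x s
    using fibre_sum_constant[OF ev d(1) that] N_pos p_pos by (simp add: w_def field_simps)
  define avg where "avg = (\<lambda>(i :: int, x :: int, s). w s)"
  define f where "f r = (if r \<in> V then u r - avg r else 0)" for r
  have "fibre_sum f x s = 0" if "x \<in> {0..<N}" "s < L" for x s
  proof -
    have "fibre_sum f x s = (\<Sum>i\<in>{0..<p}. u (i, x, s) - w s)"
      unfolding fibre_sum_def using that
      by (intro sum.cong) (auto simp: f_def avg_def V_def)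
    thus ?thesis using fs[OF that] p_pos by (simp add: sum_subtractf fibre_sum_def)
  qed
  hence f: "f \<in> fibre_zero" unfolding fibre_zero_iff by (simp add: f_def)
  \<comment> \<open>Averaging over the copies commutes with the adjacency operator, so the average
    inherits the eigenvalue equation.\<close>
  have kavg: "kop V (adj E) avg r = of_real d * avg r" if "r \<in> V" for r
  proof -
    obtain i x s where r: "r = (i, x, s)" "i \<in> {0..<p}" "x \<in> {0..<N}" "s < L"
      using \<open>r \<in> V\<close> by (auto simp: V_def)
    have m: "y mod N \<in> {0..<N}" for y using N_pos by simp
    have "of_int p * kop V (adj E) avg r = fibre_sum (kop V (adj E) u) x s"
      unfolding fibre_sum_kop[OF r(3,4)] r(1) kop_E[OF r(2-4)]
      using r by (simp add: avg_def fs m algebra_simps)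
    also have "\<dots> = of_real d * fibre_sum u x s"
      unfolding fibre_sum_def sum_distrib_left
      by (rule sum.cong[OF refl]) (use ev r in \<open>auto simp: eigenfunction_def V_def\<close>)
    also have "\<dots> = of_int p * (of_real d * avg r)"
      using fs[OF r(3,4)] by (simp add: avg_def r)
    finally show ?thesis using p_pos by simp
  qed
  have "ip V (kop V (adj E) f) f = ip V (\<lambda>r. of_real d * f r) f"
  proof (rule ip_cong)
    fix r assume r: "r \<in> V"
    have "kop V (adj E) f r = kop V (adj E) (\<lambda>r. u r - avg r) r"
      by (rule kop_cong) (simp add: f_def)
    also have "\<dots> = of_real d * f r"
      using kavg[OF r] ev r by (simp add: kop_diff eigenfunction_def f_def algebra_simps)
    finally show "kop V (adj E) f r = of_real d * f r" .
  qed simp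
  hence "d * Re (ip V f f) \<le> \<mu> * Re (ip V f f)" using bound[OF f] by (simp add: ip_scale_left)
  hence "(d - \<mu>) * Re (ip V f f) \<le> 0" by (simp add: left_diff_distrib)
  hence "Re (ip V f f) \<le> 0" using d(2) by (simp add: mult_le_0_iff)
  hence "Re (ip V f f) = 0" using ip_self_nonneg[of V f] by linarith
  hence "ip V f f = 0" by (simp add: ip_self)
  hence uw: "u r = avg r" if "r \<in> V" for r
    using that ip_self_eq_0_iff[OF finite_V, of f] by (simp add: f_def)
  have "of_real d * w s = (if s + 1 < L then 2 * w (s + 1) else 0) + 2 * w (s - 1)"
    if s: "0 < s" "s < L" for s
  proof -
    have 0: "0 \<in> {0..<p}" "0 \<in> {0..<N}" using p_pos N_pos by simp_all
    have "(0, 0, s) \<in> V" using 0 s by (simp add: V_def)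
    from kavg[OF this] show ?thesis
      unfolding kop_E[OF 0 s(2)] using s by (simp add: avg_def split: if_splits)
  qed
  moreover have "u (i, x, s) = w s" if "i \<in> {0..<p}" "x \<in> {0..<N}" "s < L" for i x s
    using uw[of "(i, x, s)"] that by (simp add: V_def avg_def)
  ultimately show ?thesis by blast
qed

lemma at_most_one_above:
  assumes ev: "eigenfunction V (adj E) d u" "eigenfunction V (adj E) e z"
    and d: "d > \<mu>" "e > \<mu>" and \<mu>: "\<mu> > 4 * cos (pi / L)"
    and bound: "\<And>f. f \<in> fibre_zero \<Longrightarrow> Re (ip V (kop V (adj E) f) f) \<le> \<mu> * Re (ip V f f)"
    and ips: "ip V u z = 0" "ip V u u = 1" "ip V z z = 1"
  shows False
proof -
  have d': "d > 4 * cos (pi / L)" "e > 4 * cos (pi / L)" using d \<mu> by auto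
  obtain w1 where w1: "\<forall>i\<in>{0..<p}. \<forall>x\<in>{0..<N}. \<forall>s<L. u (i, x, s) = w1 s"
    "\<forall>s. 0 < s \<longrightarrow> s < L \<longrightarrow> of_real d * w1 s = (if s + 1 < L then 2 * w1 (s + 1) else 0) + 2 * w1 (s - 1)"
    using eigenfunction_above_fibre_zero[OF ev(1) d'(1) d(1) bound] by blast
  obtain w2 where w2: "\<forall>i\<in>{0..<p}. \<forall>x\<in>{0..<N}. \<forall>s<L. z (i, x, s) = w2 s"
    "\<forall>s. 0 < s \<longrightarrow> s < L \<longrightarrow> of_real e * w2 s = (if s + 1 < L then 2 * w2 (s + 1) else 0) + 2 * w2 (s - 1)"
    using eigenfunction_above_fibre_zero[OF ev(2) d'(2) d(2) bound] by blast
  have "ip V u z = (\<Sum>i\<in>{0..<p}. \<Sum>x\<in>{0..<N}. \<Sum>s<L. w1 s * cnj (w2 s))"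
    unfolding ip_V using w1(1) w2(1) by (intro sum.cong refl) auto
  also have "\<dots> = of_int p * (of_int N * (\<Sum>s<L. w1 s * cnj (w2 s)))"
    using p_pos N_pos by simp
  finally have "(\<Sum>s<L. w1 s * cnj (w2 s)) = 0" using ips p_pos N_pos by simp
  hence "(\<forall>s<L. w1 s = 0) \<or> (\<forall>s<L. w2 s = 0)"
    using large_path_eigenfunctions_not_orthogonal[of L d e w1 w2] L_ge d' w1(2) w2(2) by simp
  thus False
  proof
    assume "\<forall>s<L. w1 s = 0"
    hence "\<forall>r\<in>V. u r = 0" using w1(1) by (auto simp: V_def)
    thus False using ips ip_self_eq_0_iff[OF finite_V, of u] by simp
  next
    assume "\<forall>s<L. w2 s = 0"
    hence "\<forall>r\<in>V. z r = 0" using w2(1) by (auto simp: V_def)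
    thus False using ips ip_self_eq_0_iff[OF finite_V, of z] by simp
  qed
qed

section \<open>Multiplicity from the dilations\<close>

text \<open>A nontrivial Fourier component in the first coordinate is moved by the dilations
  \<open>(i, x) \<mapsto> (\<gamma> y * i, x + y)\<close> to components at all other nontrivial frequencies.\<close>

lemma eigenfunction_family:
  assumes u: "u \<in> fibre_zero" "ip V u u = 1" and ev: "eigenfunction V (adj E) \<mu> u"
  shows "\<exists>us. length us = nat N \<and> orthonormal V us \<and> (\<forall>f\<in>set us. eigenfunction V (adj E) \<mu> f)"
proof -
  have mN: "y mod N \<in> {0..<N}" for y using N_pos by simp
  \<comment> \<open>The component at frequency 0 is the fibre sum, which vanishes; a nonzero
    \<open>u\<close> must therefore have a nontrivial one.\<close>
  have "\<exists>t x s. 0 < t \<and> t < p \<and> x \<in> {0..<N} \<and> s < L \<and> fc p (\<lambda>i. u (i, x, s)) t \<noteq> 0"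
  proof (rule ccontr)
    assume neg: "\<not> ?thesis"
    have "u r = 0" if r: "r \<in> V" for r
    proof -
      obtain i x s where ixs: "r = (i, x, s)" "i \<in> {0..<p}" "x \<in> {0..<N}" "s < L"
        using r by (auto simp: V_def)
      have "of_int p * u (i, x, s) = fc p (\<lambda>i. u (i, x, s)) 0"
        by (rule constant_if_fc_zero[OF p_pos _ ixs(2)]) (use neg ixs in blast)
      also have "\<dots> = fibre_sum u x s" by (simp add: fc_0 fibre_sum_def)
      also have "\<dots> = 0" using u(1) ixs unfolding fibre_zero_iff by blast
      finally show ?thesis using p_pos ixs by simp
    qed
    hence "ip V u u = 0" by (simp add: ip_def)
    thus False using u by simp
  qed
  then obtain t x0 s0 where t: "0 < t" "t < p"
    and x0: "x0 \<in> {0..<N}" "s0 < L" "fc p (\<lambda>i. u (i, x0, s0)) t \<noteq> 0" by blast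
  define W where "W x s = fc p (\<lambda>i. u (i, x, s)) t" for x s
  have Weq: "of_real \<mu> * W x s =
      (if s + 1 < L then W x (s + 1) + W ((x + v s) mod N) (s + 1) else 0) +
      (if s > 0 then W x (s - 1) + W ((x - v (s - 1)) mod N) (s - 1) else 0) +
      (if s = 0 then \<omega> p (t * \<gamma> x) * W ((x + H) mod N) 0 else 0)"
    if xs: "x \<in> {0..<N}" "s < L" for x s
  proof -
    have "of_real \<mu> * W x s = fc p (\<lambda>i. of_real \<mu> * u (i, x, s)) t"
      by (simp add: W_def fc_scale)
    also have "\<dots> = fc p (\<lambda>i. kop V (adj E) u (i, x, s)) t"
      by (rule fc_cong) (use ev xs in \<open>auto simp: eigenfunction_def V_def\<close>)
    also have "\<dots> = fc p (\<lambda>i.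
      (if s + 1 < L then u (i, x, s + 1) + u (i, (x + v s) mod N, s + 1) else 0) +
      (if s > 0 then u (i, x, s - 1) + u (i, (x - v (s - 1)) mod N, s - 1) else 0) +
      (if s = 0 then u ((i + \<gamma> x) mod p, (x + H) mod N, 0) else 0)) t"
      by (rule fc_cong) (use kop_E xs in simp)
    also have "\<dots> = (if s + 1 < L then W x (s + 1) + W ((x + v s) mod N) (s + 1) else 0) +
      (if s > 0 then W x (s - 1) + W ((x - v (s - 1)) mod N) (s - 1) else 0) +
      (if s = 0 then \<omega> p (t * \<gamma> x) * W ((x + H) mod N) 0 else 0)"
    proof -
      have fc_zero: "fc p (\<lambda>i. 0) t = 0" by (simp add: fc_def)
      have sh: "fc p (\<lambda>i. u ((i + \<gamma> x) mod p, (x + H) mod N, 0)) t = \<omega> p (t * \<gamma> x) * W ((x + H) mod N) 0"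
        unfolding W_def by (rule fc_shift[OF p_pos, of "\<lambda>i. u (i, (x + H) mod N, 0)"])
      show ?thesis
        unfolding fc_add using sh by (auto simp: fc_add fc_zero W_def[symmetric])
    qed
    finally show ?thesis .
  qed
  \<comment> \<open>\<open>F y\<close> has the single frequency \<open>t * \<gamma> y\<close> in the
    first coordinate. For y < N these are distinct modulo p, and this alone gives
    orthogonality.\<close>
  define F where "F y = (\<lambda>(i, x, s). \<omega> p (t * \<gamma> (int y) * i) * W ((x + int y) mod N) s)" for y
  have evF: "eigenfunction V (adj E) \<mu> (F y)" for y
    unfolding eigenfunction_def
  proof
    fix r assume "r \<in> V"
    then obtain i x s where r: "r = (i, x, s)" "i \<in> {0..<p}" "x \<in> {0..<N}" "s < L"
      by (auto simp: V_def)
    define y' where "y' = int y"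
    define q where "q = (x + y') mod N"
    have q: "q \<in> {0..<N}" unfolding q_def by (rule mN)
    have sh: "((x + k) mod N + y') mod N = (q + k) mod N" for k
      by (simp add: q_def mod_simps algebra_simps)
    have sh': "((x - k) mod N + y') mod N = (q - k) mod N" for k
      using sh[of "- k"] by simp
    \<comment> \<open>The phase that the matching produces at \<open>x\<close> for the new frequency
      is the phase in \<open>Weq\<close> at the shifted point \<open>q\<close>, since \<gamma> y'
      times \<gamma> x is \<gamma> q modulo p.\<close>
    have \<omega>i: "\<omega> p (t * \<gamma> y' * ((i + \<gamma> x) mod p)) = \<omega> p (t * \<gamma> y' * i) * \<omega> p (t * \<gamma> q)"
    proof -
      have "\<gamma> q = \<gamma> (x + y')" using \<gamma>_mod[of "x + y'"] by (simp add: q_def N_def)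
      hence "[\<gamma> y' * \<gamma> x = \<gamma> q] (mod p)" using \<gamma>_add[of x y'] by (simp add: cong_sym_eq mult.commute)
      hence "[t * (\<gamma> y' * \<gamma> x) = t * \<gamma> q] (mod p)" by (rule cong_scalar_left)
      hence "[t * \<gamma> y' * i + t * (\<gamma> y' * \<gamma> x) = t * \<gamma> y' * i + t * \<gamma> q] (mod p)"
        by (intro cong_add cong_refl)
      moreover have "[t * \<gamma> y' * ((i + \<gamma> x) mod p) = t * \<gamma> y' * (i + \<gamma> x)] (mod p)"
        by (intro cong_scalar_left) (simp add: cong_def)
      moreover have "t * \<gamma> y' * (i + \<gamma> x) = t * \<gamma> y' * i + t * (\<gamma> y' * \<gamma> x)"
        by (simp add: algebra_simps)
      ultimately have "[t * \<gamma> y' * ((i + \<gamma> x) mod p) = t * \<gamma> y' * i + t * \<gamma> q] (mod p)"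
        by (metis cong_trans)
      from \<omega>_cong[OF p_pos this] show ?thesis by (simp add: \<omega>_add)
    qed
    have Fy: "F y (j, z, s) = \<omega> p (t * \<gamma> y' * j) * W ((z + y') mod N) s" for j z s
      by (simp add: F_def y'_def)
    have "kop V (adj E) (F y) r = \<omega> p (t * \<gamma> y' * i) * (of_real \<mu> * W q s)"
      unfolding Weq[OF q r(4)] unfolding r(1) kop_E[OF r(2-4)] Fy sh sh' \<omega>i q_def[symmetric]
      by (simp add: distrib_left)
    also have "\<dots> = of_real \<mu> * F y r" by (simp add: F_def r y'_def[symmetric] q_def)
    finally show "kop V (adj E) (F y) r = of_real \<mu> * F y r" .
  qed
  have orth: "ip V (F y) (F z) = 0" if yz: "y < nat N" "z < nat N" "y \<noteq> z" for y z
  proof -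
    have "\<not> p dvd t * (\<gamma> (int y) - \<gamma> (int z))"
    proof
      assume "p dvd t * (\<gamma> (int y) - \<gamma> (int z))"
      hence "p dvd t \<or> p dvd \<gamma> (int y) - \<gamma> (int z)" using prime_p by (simp add: prime_dvd_mult_iff)
      moreover have "\<not> p dvd t" using t zdvd_not_zless by blast
      ultimately have "\<gamma> (int y) mod p = \<gamma> (int z) mod p" by (simp add: mod_eq_dvd_iff)
      hence eq: "\<gamma> (int y) = \<gamma> (int z)" using \<gamma>_range[of "int y"] \<gamma>_range[of "int z"] by simp
      have "int y \<in> {0..<N}" "int z \<in> {0..<N}" using yz by auto
      hence "int y = int z" using eq by (rule \<gamma>_inj)
      thus False using yz by simp
    qed
    hence zero: "(\<Sum>i\<in>{0..<p}. \<omega> p ((t * (\<gamma> (int y) - \<gamma> (int z))) * i)) = 0"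
      using sum_\<omega>[OF p_pos] by simp
    have "ip V (F y) (F z) = (\<Sum>i\<in>{0..<p}. \<Sum>x\<in>{0..<N}. \<Sum>s<L.
        \<omega> p ((t * (\<gamma> (int y) - \<gamma> (int z))) * i) * (W ((x + int y) mod N) s * cnj (W ((x + int z) mod N) s)))"
      unfolding ip_V
    proof (intro sum.cong refl)
      fix i x s
      have "\<omega> p ((t * (\<gamma> (int y) - \<gamma> (int z))) * i) = \<omega> p (t * \<gamma> (int y) * i) * \<omega> p (- (t * \<gamma> (int z) * i))"
        by (simp add: \<omega>_add[symmetric] algebra_simps)
      thus "F y (i, x, s) * cnj (F z (i, x, s)) = \<omega> p ((t * (\<gamma> (int y) - \<gamma> (int z))) * i) *
          (W ((x + int y) mod N) s * cnj (W ((x + int z) mod N) s))"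
        by (simp add: F_def cnj_\<omega> mult_ac)
    qed
    also have "\<dots> = (\<Sum>i\<in>{0..<p}. \<omega> p ((t * (\<gamma> (int y) - \<gamma> (int z))) * i)) *
        (\<Sum>x\<in>{0..<N}. \<Sum>s<L. W ((x + int y) mod N) s * cnj (W ((x + int z) mod N) s))"
      by (simp only: sum_distrib_left[symmetric] sum_distrib_right[symmetric])
    finally show ?thesis unfolding zero by simp
  qed
  have nz: "\<exists>r\<in>V. F y r \<noteq> 0" for y
  proof
    show "(0, (x0 - int y) mod N, s0) \<in> V" using p_pos x0 mN by (simp add: V_def)
    have "((x0 - int y) mod N + int y) mod N = x0" using x0 by (simp add: mod_simps)
    thus "F y (0, (x0 - int y) mod N, s0) \<noteq> 0" using x0 by (simp add: F_def W_def)
  qed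
  from orthonormal_eigenfunctions_from_family[where n = "nat N" and F = F and a = "adj E", OF finite_V evF orth nz]
  show ?thesis .
qed

theorem relabelled_second_eigenvalue_multiplicity:
  assumes h: "bij_betw h V {0..<card V}"
  shows "nat N \<le> second_eigenvalue_multiplicity (relabel h V E)"
proof -
  interpret relabelled_graph V E h
    by unfold_locales (use E_subset sym_E irrefl_E h in auto)
  obtain \<mu> u where u: "\<mu> > 4 * cos (pi / L)" "u \<in> fibre_zero" "ip V u u = 1" "eigenfunction V (adj E) \<mu> u"
    and bound: "\<And>f. f \<in> fibre_zero \<Longrightarrow> Re (ip V (kop V (adj E) f) f) \<le> \<mu> * Re (ip V f f)"
    using top_fibre_zero_eigenfunction by blast
  obtain us where us: "length us = nat N" "orthonormal V us" "\<forall>f\<in>set us. eigenfunction V (adj E) \<mu> f"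
    using eigenfunction_family[OF u(2-4)] by blast
  have "nat N * 1 \<le> nat N * (nat p * L)"
    using p_pos L_ge by (intro mult_left_mono) auto
  hence "length us \<le> card V" using us(1) by (simp add: card_V mult_ac)
  moreover have "2 \<le> length us" using us(1) N_ge by simp
  ultimately have "length us \<le> second_eigenvalue_multiplicity (relabel h V E)"
    using us at_most_one_above[OF _ _ _ _ u(1) bound]
    by (intro second_eigenvalue_multiplicity_G[where \<mu> = \<mu>]) blast+
  thus ?thesis using us(1) by simp
qed

end

section \<open>Infinitely many examples\<close>

text \<open>Powers of a primitive root, with exponents reduced modulo p - 1. At the half period the
  value squares to 1 and differs from 1 by injectivity, so it is -1 modulo the prime.\<close>

lemma exists_discrete_exponential:
  fixes q :: nat
  assumes q: "prime q" "q > 2"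
  defines "p \<equiv> int q"
  shows "\<exists>\<gamma>. bij_betw \<gamma> {0..<p - 1} {1..<p} \<and> (\<forall>x. \<gamma> (x mod (p - 1)) = \<gamma> x) \<and>
    (\<forall>x y. [\<gamma> (x + y) = \<gamma> x * \<gamma> y] (mod p)) \<and>
    (\<forall>x. [\<gamma> (x + (p - 1) div 2) = - \<gamma> x] (mod p)) \<and> \<gamma> 0 = 1"
proof -
  obtain g where g: "residue_primroot q g"
    using prime_primitive_root_exists[of q] q by auto
  have cop: "coprime q g" and ord: "ord q g = q - 1"
    using g q totient_prime by (auto simp: residue_primroot_def)
  have pN: "p - 1 > 0" "p > 1" using q by (auto simp: p_def)
  define \<gamma> where "\<gamma> x = int (g ^ nat (x mod (p - 1)) mod q)" for x :: int
  have per: "\<gamma> (x mod (p - 1)) = \<gamma> x" for x by (simp add: \<gamma>_def)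
  have qp: "int (q - 1) = p - 1" using q by (simp add: p_def of_nat_diff)
  have add: "[\<gamma> (x + y) = \<gamma> x * \<gamma> y] (mod p)" for x y
  proof -
    define a b c where "a = nat (x mod (p - 1))" and "b = nat (y mod (p - 1))"
      and "c = nat ((x + y) mod (p - 1))"
    have "[int c = int (a + b)] (mod int (q - 1))"
      using pN unfolding qp by (simp add: a_def b_def c_def cong_def mod_simps)
    hence "[c = a + b] (mod ord q g)" unfolding ord by (simp only: cong_int_iff)
    hence "[g ^ c = g ^ (a + b)] (mod q)" using order_divides_expdiff[OF cop] by blast
    hence "[g ^ c mod q = (g ^ a mod q) * (g ^ b mod q)] (mod q)"
      by (simp add: cong_def power_add mod_simps)
    hence "[int (g ^ c mod q) = int ((g ^ a mod q) * (g ^ b mod q))] (mod int q)"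
      by (simp only: cong_int_iff)
    thus ?thesis by (simp only: \<gamma>_def a_def b_def c_def p_def of_nat_mult)
  qed
  have range: "\<gamma> x \<in> {1..<p}" for x
  proof -
    have "coprime q (g ^ n)" for n using cop by simp
    hence "\<not> q dvd g ^ n" for n using q by (metis coprime_absorb_left not_prime_unit)
    hence "g ^ n mod q > 0" for n by (simp add: mod_greater_zero_iff_not_dvd)
    moreover have "g ^ n mod q < q" for n using q by simp
    ultimately show ?thesis by (auto simp: \<gamma>_def p_def Suc_leI)
  qed
  have inj: "inj_on \<gamma> {0..<p - 1}"
  proof (rule inj_onI)
    fix x y assume xy: "x \<in> {0..<p - 1}" "y \<in> {0..<p - 1}" "\<gamma> x = \<gamma> y"
    hence "[g ^ nat x = g ^ nat y] (mod q)" by (simp add: \<gamma>_def cong_def)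
    hence "[nat x = nat y] (mod (q - 1))" using order_divides_expdiff[OF cop] ord by metis
    moreover have "nat x < q - 1" "nat y < q - 1" using xy qp by auto
    ultimately have "nat x = nat y" by (simp add: cong_def)
    thus "x = y" using xy(1,2) by (simp add: eq_nat_nat_iff)
  qed
  have "card {1..<p} = card (\<gamma> ` {0..<p - 1})" using inj by (simp add: card_image)
  hence "\<gamma> ` {0..<p - 1} = {1..<p}"
    using range by (intro card_subset_eq) auto
  hence bij: "bij_betw \<gamma> {0..<p - 1} {1..<p}" using inj by (simp add: bij_betw_def)
  have zero: "\<gamma> 0 = 1" using q by (simp add: \<gamma>_def)
  define H where "H = (p - 1) div 2"
  have "odd q" using q prime_odd_nat by blast
  hence H: "2 * H = p - 1" "0 < H" "H < p - 1" using q by (auto simp: H_def p_def)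
  have pprime: "prime p" using q by (simp add: p_def)
  have "\<gamma> (H + H) = \<gamma> 0" using per[of "H + H"] H by simp
  hence "[\<gamma> H * \<gamma> H = 1] (mod p)" using add[of H H] zero by (simp add: cong_sym)
  hence "p dvd (\<gamma> H - 1) * (\<gamma> H + 1)"
    by (simp add: cong_iff_dvd_diff algebra_simps)
  hence "p dvd \<gamma> H - 1 \<or> p dvd \<gamma> H + 1" using pprime by (simp add: prime_dvd_mult_iff)
  moreover have "\<not> p dvd \<gamma> H - 1"
  proof
    assume "p dvd \<gamma> H - 1"
    moreover have "0 \<le> \<gamma> H - 1" "\<gamma> H - 1 < p" using range[of H] by auto
    ultimately have "\<gamma> H = \<gamma> 0" using zero zdvd_not_zless[of "\<gamma> H - 1" p] by force
    hence "H = 0" using inj H by (auto dest: inj_onD)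
    thus False using H by simp
  qed
  ultimately have half: "[\<gamma> H = - 1] (mod p)" by (simp add: cong_iff_dvd_diff)
  have "[\<gamma> (x + H) = - \<gamma> x] (mod p)" for x
    using cong_trans[OF add[of x H] cong_scalar_left[OF half, of "\<gamma> x"]] by simp
  thus ?thesis using bij per add zero unfolding H_def by blast
qed

text \<open>From m = 30 on, passing from m to m + 1 at most doubles the cube. With L = k + 9 this is
  the condition \<open>L_le\<close>.\<close>

lemma cube_less_exp: "k \<ge> 20 \<Longrightarrow> (k + 10) ^ 3 < (2 :: nat) ^ k"
proof (induction k rule: nat_induct_at_least)
  case (Suc k)
  define m where "m = k + 10"
  have "m \<ge> 30" using Suc by (simp add: m_def)
  have "(m + 1) ^ 3 = m ^ 3 + (3 * m\<^sup>2 + 3 * m + 1)"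
    by (simp add: power3_eq_cube power2_eq_square algebra_simps)
  also have "3 * m\<^sup>2 + 3 * m + 1 \<le> 5 * (m * m)"
  proof -
    have "30 * m \<le> m * m" using \<open>m \<ge> 30\<close> by (rule mult_le_mono1)
    thus ?thesis using \<open>m \<ge> 30\<close> unfolding power2_eq_square by linarith
  qed
  also have "\<dots> \<le> m * (m * m)" using \<open>m \<ge> 30\<close> by (intro mult_right_mono) auto
  also have "m ^ 3 + m * (m * m) = 2 * m ^ 3" by (simp add: power3_eq_cube)
  finally show ?case using Suc by (simp add: m_def)
qed simp

lemma good_graph:
  fixes q :: nat
  assumes q: "prime q" "q \<ge> 2 ^ 20"
  shows "\<exists>G :: nat pair_pre_digraph. card (pverts G) \<ge> q \<and> pair_graph G \<and>
    Digraph_Component.connected (with_proj G) \<and> max_degree G = 4 \<and>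
    real (second_eigenvalue_multiplicity G)
      \<ge> sqrt (real (card (pverts G)) / log 2 (real (card (pverts G))))"
proof -
  have "q > 2" using q by simp
  obtain k where k: "2 ^ k \<le> q" "q < 2 ^ (k + 1)"
    using ex_power_ivl1[of 2 q] q by auto
  have "(2 :: nat) ^ 20 < 2 ^ (k + 1)" using q k by linarith
  hence "20 < k + 1" by (rule power_less_imp_less_exp[rotated]) simp
  hence k20: "k \<ge> 20" by simp
  define p where "p = int q"
  \<comment> \<open>The doubling exponent \<open>j\<close> is at most \<open>k\<close> and its power
    of 2 sits at position \<open>b = j + 3\<close>; the margin \<open>b + 6 <= L\<close> then asks
    for \<open>k + 9\<close>.\<close>
  define L where "L = k + 9"
  \<comment> \<open>The offset 3 keeps the powers away from the bottom; the default 1 keeps all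
    shifts between 0 and p - 1 and makes \<open>v 0 = 1\<close>.\<close>
  define v where "v s = (if 3 \<le> s \<and> 2 ^ (s - 3) < p - 1 then 2 ^ (s - 3) else 1 :: int)" for s
  obtain \<gamma> where \<gamma>: "bij_betw \<gamma> {0..<p - 1} {1..<p}" "\<forall>x. \<gamma> (x mod (p - 1)) = \<gamma> x"
    "\<forall>x y. [\<gamma> (x + y) = \<gamma> x * \<gamma> y] (mod p)"
    "\<forall>x. [\<gamma> (x + (p - 1) div 2) = - \<gamma> x] (mod p)" "\<gamma> 0 = 1"
    using exists_discrete_exponential[OF q(1) \<open>q > 2\<close>] unfolding p_def by blast
  interpret layered_affine_graph p \<gamma> L v
  proof
    show "prime p" "p > 2" using q \<open>q > 2\<close> by (auto simp: p_def)
    show "L \<ge> 12" using k20 by (simp add: L_def)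
    have "L + 1 = k + 10" by (simp add: L_def)
    hence "(L + 1) ^ 3 = (k + 10) ^ 3" by (simp only:)
    hence "(L + 1) ^ 3 \<le> q - 1" using cube_less_exp[OF k20] k by linarith
    hence "real ((L + 1) ^ 3) \<le> real (q - 1)" by (simp only: of_nat_le_iff)
    thus "real (L + 1) ^ 3 \<le> of_int (p - 1)" using \<open>q > 2\<close> by (simp add: p_def of_nat_diff)
    show "0 < v s \<and> v s < p - 1" for s using \<open>q > 2\<close> by (simp add: v_def p_def)
    show "v 0 = 1" by (simp add: v_def)
    fix a assume a: "0 < a" "a < p - 1"
    have "0 < nat a" "nat a < q - 1" using a by (auto simp: p_def)
    from exists_doubling_in_left_half[OF this] obtain j where j: "2 ^ j < q - 1"
      and cos: "cos (2 * pi * (real (nat a) * 2 ^ j) / real (q - 1)) \<le> 0" by blast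
    have "(2 :: nat) ^ j < 2 ^ (k + 1)" using j k by linarith
    hence "j < k + 1" by (rule power_less_imp_less_exp[rotated]) simp
    have "int (2 ^ j) < int (q - 1)" using j by (simp only: of_nat_less_iff)
    hence "2 ^ j < p - 1" using \<open>q > 2\<close> by (simp add: p_def of_nat_diff)
    hence vj: "v (j + 3) = 2 ^ j" by (simp add: v_def)
    have "cos (2 * pi * of_int (a * v (j + 3)) / of_int (p - 1)) \<le> 0"
      using cos a \<open>q > 2\<close> by (simp add: vj p_def of_nat_diff)
    thus "\<exists>b. 3 \<le> b \<and> b + 6 \<le> L \<and> cos (2 * pi * of_int (a * v b) / of_int (p - 1)) \<le> 0"
      using \<open>j < k + 1\<close> by (intro exI[of _ "j + 3"]) (auto simp: L_def)
  qed (use \<gamma> in auto)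
  obtain h where h: "bij_betw h V {0..<card V}"
    using ex_bij_betw_finite_nat[OF finite_V] by blast
  interpret R: relabelled_graph V E h
    by unfold_locales (use E_subset sym_E irrefl_E h in auto)
  have N_q: "nat N = q - 1" unfolding N_def by (simp add: p_def nat_diff_distrib)
  have n: "card (pverts R.G) = q * (q - 1) * L"
  proof -
    have "nat p = q" by (simp add: p_def)
    hence "card V = q * (q - 1) * L" by (simp only: card_V N_q)
    thus ?thesis by (simp only: R.pverts_G card_atLeastLessThan diff_zero)
  qed
  have origin: "(0, 0, s) \<in> V" if "s < L" for s
    using that p_pos N_pos by (simp add: V_def)
  have "card (E `` {u}) \<le> 4" if "u \<in> V" for u
    using card_nbrs_le[OF that] E_image[OF that] by simp
  moreover have "card (E `` {(0, 0, 1)}) = 4"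
    using E_image[OF origin[of 1]] card_nbrs_eq L_ge by simp
  ultimately have deg: "max_degree R.G = 4"
    using R.max_degree_G[OF _ origin[of 1]] L_ge by simp
  have conn: "Digraph_Component.connected (with_proj R.G)"
    using R.connected_G[OF origin[of 0] reach_origin] L_ge by simp
  have mult: "real (second_eigenvalue_multiplicity R.G) \<ge> real (q - 1)"
    using relabelled_second_eigenvalue_multiplicity[OF h] unfolding N_q by simp
  define m where "m = real (card (pverts R.G))"
  define Q where "Q = real q"
  have Qk: "Q \<ge> 2 ^ k" using of_nat_mono[OF k(1), where 'a = real] by (simp add: Q_def)
  have q1: "real (q - 1) = Q - 1" using \<open>q > 2\<close> by (simp add: Q_def of_nat_diff)
  have m: "m = Q * (Q - 1) * (real k + 9)"
    unfolding m_def n of_nat_mult q1 Q_def[symmetric] by (simp add: L_def)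
  have "Q \<ge> 2" using \<open>q > 2\<close> by (simp add: Q_def)
  have "2 ^ k * (2 ^ k) \<le> Q * Q" using Qk \<open>Q \<ge> 2\<close> by (intro mult_mono) auto
  also have "Q * Q \<le> Q * ((Q - 1) * (real k + 9))"
  proof (intro mult_left_mono)
    have "Q \<le> (Q - 1) * 2" using \<open>Q \<ge> 2\<close> by simp
    also have "\<dots> \<le> (Q - 1) * (real k + 9)" using \<open>Q \<ge> 2\<close> by (intro mult_left_mono) auto
    finally show "Q \<le> (Q - 1) * (real k + 9)" .
  qed (use \<open>Q \<ge> 2\<close> in simp)
  finally have le_m: "2 ^ (2 * k) \<le> m" by (simp add: m mult.assoc power_mult power2_eq_square mult_2 power_add)
  have "log 2 (2 ^ (2 * k)) \<le> log 2 m" by (rule log_mono[OF _ _ le_m]) simp_all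
  hence log: "log 2 m \<ge> 2 * real k" by simp
  have kpos: "2 * real k > 0" using k20 by simp
  \<comment> \<open>The number of vertices is about q^2 L, so its logarithm is at least 2k, while L
    is only k + 9. This factor of almost 2 absorbs both the 9 and the replacement of
    \<open>Q\<close> by \<open>Q - 1\<close>.\<close>
  have "Q * (real k + 9) \<le> (Q - 1) * (2 * real k)"
  proof -
    have "k < 2 ^ k" by (rule less_exp)
    hence "real k \<le> real (2 ^ k)" by (simp only: of_nat_le_iff)
    also have "\<dots> = 2 ^ k" by simp
    finally have "real k \<le> Q" using Qk by linarith
    moreover have "Q * 2 \<le> Q * (real k - 9)" using k20 \<open>Q \<ge> 2\<close> by (intro mult_left_mono) auto
    ultimately show ?thesis by (simp add: algebra_simps)
  qed
  hence "(Q - 1) * (Q * (real k + 9)) \<le> (Q - 1) * ((Q - 1) * (2 * real k))"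
    using \<open>Q \<ge> 2\<close> by (intro mult_left_mono) auto
  hence "m \<le> (Q - 1)\<^sup>2 * (2 * real k)"
    by (simp add: m power2_eq_square mult_ac)
  also have "\<dots> \<le> (Q - 1)\<^sup>2 * log 2 m" using log by (intro mult_left_mono) auto
  finally have "m / log 2 m \<le> (Q - 1)\<^sup>2" using log kpos by (simp add: pos_divide_le_eq)
  hence "sqrt (m / log 2 m) \<le> Q - 1" using \<open>Q \<ge> 2\<close> by (intro real_le_lsqrt) auto
  hence "sqrt (m / log 2 m) \<le> real (second_eigenvalue_multiplicity R.G)"
    using mult q1 by linarith
  moreover have "q * 1 \<le> q * ((q - 1) * L)"
    using \<open>q > 2\<close> L_ge by (intro mult_left_mono) auto
  hence "card (pverts R.G) \<ge> q" by (simp add: n mult.assoc)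
  ultimately show ?thesis
    using R.pair_graph_G conn deg unfolding m_def by blast
qed

lemma digraph_iso_card:
  assumes "digraph_iso (with_proj G) (with_proj H)"
  shows "card (pverts G) = card (pverts H)"
proof -
  obtain f where f: "pre_digraph.digraph_isomorphism (with_proj G) f" "with_proj H = app_iso f (with_proj G)"
    using assms by (auto simp: digraph_iso_def)
  have "pverts H = verts (with_proj H)" by simp
  also have "\<dots> = iso_verts f ` pverts G" unfolding f(2) by simp
  finally show ?thesis using card_verts_iso[OF f(1)] by simp
qed

theorem theorem1p5:
  shows "\<exists>S :: nat pair_pre_digraph set.
    infinite S \<and>
    (\<forall>G\<in>S. \<forall>H\<in>S. G \<noteq> H \<longrightarrow> \<not> digraph_iso (with_proj G) (with_proj H)) \<and>
    (\<forall>G\<in>S.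
      pair_graph G \<and>
      Digraph_Component.connected (with_proj G) \<and>
      max_degree G = 4 \<and>
      real (second_eigenvalue_multiplicity G)
        \<ge> sqrt (real (card (pverts G)) / log 2 (real (card (pverts G)))))"
proof -
  define good :: "nat pair_pre_digraph \<Rightarrow> bool" where
    "good G \<longleftrightarrow> pair_graph G \<and> Digraph_Component.connected (with_proj G) \<and> max_degree G = 4 \<and>
      real (second_eigenvalue_multiplicity G)
        \<ge> sqrt (real (card (pverts G)) / log 2 (real (card (pverts G))))" for G
  \<comment> \<open>One graph is kept for each attained number of vertices, so that distinct members
    differ in size and cannot be isomorphic.\<close>
  define sizes where "sizes = {n. \<exists>G. good G \<and> card (pverts G) = n}"
  define pick where "pick n = (SOME G. good G \<and> card (pverts G) = n)" for n
  have pick: "good (pick n) \<and> card (pverts (pick n)) = n" if "n \<in> sizes" for n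
    unfolding pick_def by (rule someI_ex) (use that in \<open>simp add: sizes_def\<close>)
  have "infinite sizes"
    unfolding infinite_nat_iff_unbounded_le
  proof
    fix b :: nat
    obtain q where q: "prime q" "q > max b (2 ^ 20)" using bigger_prime[of "max b (2 ^ 20)"] by blast
    obtain G where "card (pverts G) \<ge> q" "good G"
      using good_graph[of q] q unfolding good_def by auto
    thus "\<exists>n\<ge>b. n \<in> sizes" using q by (intro exI[of _ "card (pverts G)"]) (auto simp: sizes_def)
  qed
  moreover have "inj_on pick sizes" by (rule inj_onI) (metis pick)
  ultimately have "infinite (pick ` sizes)" by (simp add: finite_image_iff)
  moreover have "\<forall>G\<in>pick ` sizes. \<forall>H\<in>pick ` sizes. G \<noteq> H \<longrightarrow> \<not> digraph_iso (with_proj G) (with_proj H)"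
  proof (intro ballI impI notI)
    fix G H
    assume GH: "G \<in> pick ` sizes" "H \<in> pick ` sizes" "G \<noteq> H"
    assume iso: "digraph_iso (with_proj G) (with_proj H)"
    obtain m n where mn: "m \<in> sizes" "n \<in> sizes" "G = pick m" "H = pick n" using GH by blast
    hence "m = n" using pick[OF mn(1)] pick[OF mn(2)] digraph_iso_card[OF iso] by simp
    thus False using mn GH(3) by simp
  qed
  moreover have "\<forall>G\<in>pick ` sizes. good G"
  proof
    fix G
    assume "G \<in> pick ` sizes"
    then obtain n where "n \<in> sizes" "G = pick n" by blast
    thus "good G" using pick by simp
  qed
  ultimately show ?thesis
    unfolding good_def by (intro exI[of _ "pick ` sizes"] conjI)
qed

end
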